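(* Let $k \geq 2$. Let $G, H_1, H_2$ be $k$-graphs with $m_k(H_1) \geq m_k(H_2)>1$, $m(G) \leq m_k(H_1,H_2)$ and $(H_1, H_2)$ a heart. Then $G \not\to (H_1,H_2)$ if either of the following conditions is satisfied: (i) $\chi(H_2) \geq k+1$; (ii) $m(H_2) > \binom{v(H_1)}{k-2}+1$.
   Context: A $k$-graph is a finite $k$-uniform hypergraph; it is non-empty if it has at least one edge; $v(H),e(H)$ are the numbers of vertices and edges; $J \subseteq H$ means $J$ is a (not necessarily induced) subhypergraph. $G \to (H_1,H_2)$ means: every colouring of the edges of $G$ with colours $1,2$ yields a copy of $H_1$ with all edges of colour $1$ or a copy of $H_2$ with all edges of colour $2$; $G\not\to(H_1,H_2)$ is the negation. Densities: $d(H)=e(H)/v(H)$ if $v(H)\ge 1$ and $0$ otherwise; $m(H)=\max\{d(J):J\subseteq H\}$. $d_k(H)=(e(H)-1)/(v(H)-k)$ if $H$ is non-empty with $v(H)\geq k+1$, $d_k(H)=1/k$ if $H\cong K_k$ (a single edge on $k$ vertices), and $d_k(H)=0$ otherwise; $m_k(H)=\max\{d_k(J):J\subseteq H\}$. $H$ is strictly $k$-balanced if $d_k(J)<m_k(H)$ for all proper subhypergraphs $J\subsetneq H$. For $k$-graphs with $m_k(H_1)\geq m_k(H_2)$: $d_k(H_1,H_2)=\frac{e(H_1)}{v(H_1)-k+1/m_k(H_2)}$ if $H_2$ is non-empty and $v(H_1)\geq k$, and $0$ otherwise (the same formula defines $d_k(J,H_2)$ for $J\subseteq H_1$); $m_k(H_1,H_2)=\max\{d_k(J,H_2):J\subseteq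 H_1\}$. $H_1$ is strictly balanced with respect to $d_k(\cdot,H_2)$ if $d_k(J,H_2)<m_k(H_1,H_2)$ for all proper $J\subsetneq H_1$. Heart: a pair $(H_1,H_2)$ with $m_k(H_1)\geq m_k(H_2)$ is a heart if $H_2$ is strictly $k$-balanced; $H_1$ is strictly $k$-balanced when $m_k(H_1)=m_k(H_2)$; and $H_1$ is strictly balanced with respect to $d_k(\cdot,H_2)$ when $m_k(H_1)>m_k(H_2)$. $\chi(H)$ is the weak chromatic number: the minimum $t$ such that the vertices of $H$ can be $t$-coloured with no monochromatic edge. *)

theory Defs
  imports Complex_Main
begin

datatype 'a hypergraph = Hypergraph (verts: "'a set") (hedges: "'a set set")

definition k_graph :: "nat \<Rightarrow> 'a hypergraph \<Rightarrow> bool" where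
  "k_graph k H \<longleftrightarrow> finite (verts H) \<and> (\<forall>e\<in>hedges H. e \<subseteq> verts H \<and> card e = k)"

definition v_num :: "'a hypergraph \<Rightarrow> nat" where
  "v_num H = card (verts H)"

definition e_num :: "'a hypergraph \<Rightarrow> nat" where
  "e_num H = card (hedges H)"

(* Not necessarily induced, and not necessarily spanning.  A proper subhypergraph of H is a
   subhypergraph J with J \<noteq> H, so J may also differ from H in isolated vertices only. *)
definition subhypergraph :: "'a hypergraph \<Rightarrow> 'a hypergraph \<Rightarrow> bool" where
  "subhypergraph J H \<longleftrightarrow>
     verts J \<subseteq> verts H \<and> hedges J \<subseteq> hedges H \<and> (\<forall>e\<in>hedges J. e \<subseteq> verts J)"

definition isomorphic :: "'a hypergraph \<Rightarrow> 'b hypergraph \<Rightarrow> bool" where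
  "isomorphic H J \<longleftrightarrow>
     (\<exists>f. bij_betw f (verts H) (verts J) \<and> hedges J = (\<lambda>e. f ` e) ` hedges H)"

definition arrows :: "'g hypergraph \<Rightarrow> 'a hypergraph \<Rightarrow> 'b hypergraph \<Rightarrow> bool" where
  "arrows G H1 H2 \<longleftrightarrow>
     (\<forall>c :: 'g set \<Rightarrow> nat. (\<forall>e\<in>hedges G. c e \<in> {1, 2}) \<longrightarrow>
        (\<exists>J. subhypergraph J G \<and> isomorphic H1 J \<and> (\<forall>e\<in>hedges J. c e = 1)) \<or>
        (\<exists>J. subhypergraph J G \<and> isomorphic H2 J \<and> (\<forall>e\<in>hedges J. c e = 2)))"

definition dens :: "'a hypergraph \<Rightarrow> real" where
  "dens H = (if v_num H \<ge> 1 then real (e_num H) / real (v_num H) else 0)"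

definition max_dens :: "'a hypergraph \<Rightarrow> real" where
  "max_dens H = Max {dens J | J. subhypergraph J H}"

(* For a k-graph, the second case says that it is isomorphic to a single edge on k vertices. *)
definition k_dens :: "nat \<Rightarrow> 'a hypergraph \<Rightarrow> real" where
  "k_dens k H =
     (if hedges H \<noteq> {} \<and> v_num H \<ge> k + 1
        then (real (e_num H) - 1) / (real (v_num H) - real k)
      else if e_num H = 1 \<and> v_num H = k then 1 / real k
      else 0)"

definition max_k_dens :: "nat \<Rightarrow> 'a hypergraph \<Rightarrow> real" where
  "max_k_dens k H = Max {k_dens k J | J. subhypergraph J H}"

definition strictly_k_balanced :: "nat \<Rightarrow> 'a hypergraph \<Rightarrow> bool" where
  "strictly_k_balanced k H \<longleftrightarrow>
     (\<forall>J. subhypergraph J H \<and> J \<noteq> H \<longrightarrow> k_dens k J < max_k_dens k H)"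

(* The asymmetric densities are meant for pairs with max_k_dens k H1 \<ge> max_k_dens k H2. *)
definition asym_dens :: "nat \<Rightarrow> 'a hypergraph \<Rightarrow> 'b hypergraph \<Rightarrow> real" where
  "asym_dens k H1 H2 =
     (if hedges H2 \<noteq> {} \<and> v_num H1 \<ge> k
        then real (e_num H1) / (real (v_num H1) - real k + 1 / max_k_dens k H2)
      else 0)"

definition max_asym_dens :: "nat \<Rightarrow> 'a hypergraph \<Rightarrow> 'b hypergraph \<Rightarrow> real" where
  "max_asym_dens k H1 H2 = Max {asym_dens k J H2 | J. subhypergraph J H1}"

definition strictly_balanced_wrt :: "nat \<Rightarrow> 'a hypergraph \<Rightarrow> 'b hypergraph \<Rightarrow> bool" where
  "strictly_balanced_wrt k H1 H2 \<longleftrightarrow>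
     (\<forall>J. subhypergraph J H1 \<and> J \<noteq> H1 \<longrightarrow> asym_dens k J H2 < max_asym_dens k H1 H2)"

definition heart :: "nat \<Rightarrow> 'a hypergraph \<Rightarrow> 'b hypergraph \<Rightarrow> bool" where
  "heart k H1 H2 \<longleftrightarrow>
     max_k_dens k H1 \<ge> max_k_dens k H2 \<and>
     strictly_k_balanced k H2 \<and>
     (max_k_dens k H1 = max_k_dens k H2 \<longrightarrow> strictly_k_balanced k H1) \<and>
     (max_k_dens k H1 > max_k_dens k H2 \<longrightarrow> strictly_balanced_wrt k H1 H2)"

definition weakly_colourable :: "'a hypergraph \<Rightarrow> nat \<Rightarrow> bool" where
  "weakly_colourable H t \<longleftrightarrow>
     (\<exists>c :: 'a \<Rightarrow> nat. (\<forall>x\<in>verts H. c x < t) \<and>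
        (\<forall>e\<in>hedges H. \<not> (\<exists>i. \<forall>x\<in>e. c x = i)))"

(* The minimum exists if all edges have at least two vertices, see below. *)
definition weak_chromatic_number :: "'a hypergraph \<Rightarrow> nat" where
  "weak_chromatic_number H = (LEAST t. weakly_colourable H t)"

(* The maxima above range over finite non-empty sets, and the set of admissible numbers of
   colours is non-empty. *)
lemma finite_subhypergraphs:
  assumes "k_graph k H"
  shows "finite {J. subhypergraph J H}"
proof -
  have fv: "finite (verts H)" and "hedges H \<subseteq> Pow (verts H)"
    using assms by (auto simp: k_graph_def)
  then have fe: "finite (hedges H)"
    using finite_subset by blast
  have "{J. subhypergraph J H} \<subseteq>
      (\<lambda>(V, E). Hypergraph V E) ` (Pow (verts H) \<times> Pow (hedges H))"
  proof
    fix J assume "J \<in> {J. subhypergraph J H}"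
    then show "J \<in> (\<lambda>(V, E). Hypergraph V E) ` (Pow (verts H) \<times> Pow (hedges H))"
      by (cases J) (force simp: subhypergraph_def)
  qed
  then show ?thesis
    using fv fe by (meson finite_Pow_iff finite_SigmaI finite_imageI finite_subset)
qed

lemma subhypergraph_refl:
  assumes "k_graph k H"
  shows "subhypergraph H H"
  using assms by (auto simp: k_graph_def subhypergraph_def)

lemma weakly_colourable_exists:
  assumes "k_graph k H" "k \<ge> 2"
  shows "\<exists>t. weakly_colourable H t"
proof -
  have "finite (verts H)"
    using assms by (simp add: k_graph_def)
  then obtain c :: "'a \<Rightarrow> nat" and n where c: "c ` verts H = {i. i < n}" "inj_on c (verts H)"
    using finite_imp_inj_to_nat_seg by metis
  have "\<not> (\<exists>i. \<forall>x\<in>e. c x = i)" if "e \<in> hedges H" for e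
  proof
    assume "\<exists>i. \<forall>x\<in>e. c x = i"
    then obtain i where i: "\<forall>x\<in>e. c x = i" by blast
    have e: "e \<subseteq> verts H" "card e = k"
      using assms that by (auto simp: k_graph_def)
    have "c ` e \<subseteq> {i}" using i by blast
    then have "card (c ` e) \<le> 1"
      using card_mono[of "{i}" "c ` e"] by simp
    moreover have "card (c ` e) = card e"
      using c(2) e(1) by (meson card_image inj_on_subset)
    ultimately show False
      using e(2) assms(2) by simp
  qed
  moreover have "\<forall>x\<in>verts H. c x < n"
    using c(1) by blast
  ultimately show ?thesis
    unfolding weakly_colourable_def by blast
qed

end

(* In a heart every vertex of H1 has degree larger than M = m_k(H1,H2), unless v(H1) = k + 1 and
   m_k(H1) = m_k(H2), when the degree is at least M.

   (i) Partition the vertices of G into k parts; edges inside a part get colour 1, all others colour 2.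
   A copy of H2 in colour 2 would be weakly k-coloured. In a vertex-minimal set W without a
   suitable partition, each vertex has at least as many edges into every one of the k parts as the
   minimum degree of H1, so the degrees in W exceed kM, contrary to m(G) \<le> M. In the exceptional case
   the degrees are all equal to kM. For k \<ge> 3 the vertex sets of copies of H1 in W then form a
   (k+1)-uniform hypergraph with fewer edges than vertices on every vertex set, which is 2-colourable
   by a theorem of Seymour. For k = 2 the graph H1 is a triangle and M = 2, and G is coloured directly.

   (ii) As m(G) \<le> M, the edges of G can be assigned to their vertices with at most ceiling(M)
   edges at each vertex. With b = binom(v(H1), k-2) + 1, let b of the edges assigned to each vertex have
   colour 2. Then colour 2 has maximum density at most b < m(H2), while v(H1) vertices span at most
   (ceiling(M) - b) v(H1) < e(H1) edges of colour 1. *)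

theory Submission
  imports Defs
begin

section \<open>Assigning edges to vertices\<close>

text \<open>A capacitated form of Hall's theorem, by induction on the edges. The number of edges
  inside \<open>W\<close> is supermodular in \<open>W\<close>, so unions of tight sets are tight.
  Sparsity with the new edge included then leaves that edge a vertex in no tight set, where one unit
  of capacity can be spent.\<close>

lemma exists_orientation:
  fixes c :: "'v \<Rightarrow> nat"
  assumes "finite E" "finite V" "\<And>e. e \<in> E \<Longrightarrow> e \<subseteq> V"
    and "\<And>W. W \<subseteq> V \<Longrightarrow> card {e \<in> E. e \<subseteq> W} \<le> sum c W"
  shows "\<exists>a. (\<forall>e\<in>E. a e \<in> e) \<and> (\<forall>v. v \<in> V \<longrightarrow> card {e \<in> E. a e = v} \<le> c v)"
  using assms
proof (induction E arbitrary: c rule: finite_induct)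
  case empty
  then show ?case by auto
next
  case (insert e0 E)
  let ?i = "\<lambda>W. card {e \<in> E. e \<subseteq> W}"
  have fV: "finite W" if "W \<subseteq> V" for W
    using that insert.prems(1) finite_subset by blast
  have i_insert: "card {e \<in> insert e0 E. e \<subseteq> W} = (if e0 \<subseteq> W then Suc (?i W) else ?i W)" for W
  proof -
    have "{e \<in> insert e0 E. e \<subseteq> W} = (if e0 \<subseteq> W then insert e0 {e \<in> E. e \<subseteq> W} else {e \<in> E. e \<subseteq> W})"
      by auto
    then show ?thesis using insert.hyps by simp
  qed
  have le: "?i W \<le> sum c W" if "W \<subseteq> V" for W
    using insert.prems(3)[OF that] i_insert[of W] by (auto split: if_splits)
  define tight where "tight W \<longleftrightarrow> W \<subseteq> V \<and> ?i W = sum c W" for W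
  have tight_Un: "tight (A \<union> B)" if "tight A" "tight B" for A B
  proof -
    have AB: "A \<subseteq> V" "B \<subseteq> V" using that by (auto simp: tight_def)
    have "card {e \<in> E. e \<subseteq> A} + card {e \<in> E. e \<subseteq> B}
        = card ({e \<in> E. e \<subseteq> A} \<union> {e \<in> E. e \<subseteq> B}) + card ({e \<in> E. e \<subseteq> A} \<inter> {e \<in> E. e \<subseteq> B})"
      by (rule card_Un_Int) (use insert.hyps in auto)
    also have "\<dots> \<le> ?i (A \<union> B) + ?i (A \<inter> B)"
      by (intro add_mono card_mono) (use insert.hyps in auto)
    finally have "?i A + ?i B \<le> ?i (A \<union> B) + ?i (A \<inter> B)" .
    moreover have "sum c (A \<union> B) + sum c (A \<inter> B) = sum c A + sum c B"
      using AB fV by (intro sum.union_inter) auto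
    moreover have "?i (A \<inter> B) \<le> sum c (A \<inter> B)" "?i (A \<union> B) \<le> sum c (A \<union> B)"
      using AB by (intro le; blast)+
    ultimately show ?thesis
      using that AB unfolding tight_def by auto
  qed
  \<comment> \<open>Otherwise tight sets through the vertices of \<open>e0\<close> have a tight
    union containing \<open>e0\<close>, which leaves no capacity for \<open>e0\<close>
    itself.\<close>
  have "\<exists>v\<in>e0. \<forall>W. tight W \<longrightarrow> v \<notin> W"
  proof (rule ccontr)
    assume "\<not> ?thesis"
    then obtain T where T: "\<And>v. v \<in> e0 \<Longrightarrow> tight (T v) \<and> v \<in> T v"
      by metis
    have fe0: "finite e0" using insert.prems(2)[of e0] fV by auto
    have "tight (\<Union>v\<in>S. T v)" if "S \<subseteq> e0" for S
    proof -
      have "finite S" using that fe0 finite_subset by blast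
      then show ?thesis using that
      proof (induction S rule: finite_induct)
        case empty
        have "?i {} = 0" using le[of "{}"] by simp
        then show ?case by (simp add: tight_def)
      next
        case (insert x F)
        then show ?case using tight_Un[of "T x" "\<Union>v\<in>F. T v"] T by simp
      qed
    qed
    then have t: "tight (\<Union>v\<in>e0. T v)" by blast
    moreover have "e0 \<subseteq> (\<Union>v\<in>e0. T v)" using T by blast
    ultimately show False
      using insert.prems(3)[of "\<Union>v\<in>e0. T v"] i_insert[of "\<Union>v\<in>e0. T v"]
      unfolding tight_def by auto
  qed
  then obtain v where v: "v \<in> e0" and nt: "\<And>W. tight W \<Longrightarrow> v \<notin> W" by blast
  have vV: "v \<in> V" using v insert.prems(2) by blast
  define c' where "c' = c(v := c v - 1)"
  have sum_c': "?i W \<le> sum c' W" if W: "W \<subseteq> V" for W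
  proof (cases "v \<in> W")
    case True
    have "?i W < sum c W"
      using le[OF W] nt[of W] True W by (auto simp: tight_def order.order_iff_strict)
    moreover have "sum c W = c v + sum c (W - {v})"
      using True fV[OF W] by (rule sum.remove[rotated])
    moreover have "sum c' W = c' v + sum c' (W - {v})"
      using True fV[OF W] by (rule sum.remove[rotated])
    moreover have "sum c' (W - {v}) = sum c (W - {v})"
      by (rule sum.cong) (auto simp: c'_def)
    ultimately show ?thesis by (simp add: c'_def)
  next
    case False
    then have "sum c' W = sum c W" by (intro sum.cong) (auto simp: c'_def)
    then show ?thesis using le[OF W] by simp
  qed
  \<comment> \<open>Guards the truncated subtraction in \<open>c'\<close>: with capacity 0 the set
    \<open>{v}\<close> would be tight.\<close>
  have cv: "c v \<ge> 1"
  proof (rule ccontr)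
    assume "\<not> ?thesis"
    then have "tight {v}" using le[of "{v}"] vV by (simp add: tight_def)
    then show False using nt by blast
  qed
  obtain a where a: "\<forall>e\<in>E. a e \<in> e" "\<forall>u. u \<in> V \<longrightarrow> card {e \<in> E. a e = u} \<le> c' u"
    using insert.IH[of c'] insert.prems(1,2) sum_c' by auto
  have "card {e \<in> insert e0 E. (a(e0 := v)) e = u} \<le> c u" if "u \<in> V" for u
  proof -
    have "{e \<in> insert e0 E. (a(e0 := v)) e = u}
        = (if u = v then insert e0 {e \<in> E. a e = u} else {e \<in> E. a e = u})"
      using insert.hyps by auto
    then show ?thesis
      using a(2)[rule_format, OF that] insert.hyps cv by (auto simp: c'_def split: if_splits)
  qed
  moreover have "\<forall>e\<in>insert e0 E. (a(e0 := v)) e \<in> e"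
    using a(1) v insert.hyps by auto
  ultimately show ?case by blast
qed

section \<open>Two-colouring sparse hypergraphs\<close>

text \<open>Gaussian elimination over the reals: a pivot \<open>A e u\<close> removes the unknown
  \<open>u\<close> together with the equation \<open>e\<close>, so unknowns still outnumber
  equations.\<close>

lemma homogeneous_system_nontrivial_solution:
  fixes A :: "'e \<Rightarrow> 'v \<Rightarrow> real"
  assumes "finite E" "finite V" "card E < card V"
  shows "\<exists>x. (\<exists>v\<in>V. x v \<noteq> 0) \<and> (\<forall>e\<in>E. (\<Sum>v\<in>V. A e v * x v) = 0)"
  using assms
proof (induction E arbitrary: V A rule: finite_induct)
  case empty
  then have "V \<noteq> {}" by auto
  then show ?case by (intro exI[of _ "\<lambda>_. 1"]) auto
next
  case (insert e E)
  show ?case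
  proof (cases "\<forall>v\<in>V. A e v = 0")
    case True
    obtain x where "\<exists>v\<in>V. x v \<noteq> 0" "\<forall>e\<in>E. (\<Sum>v\<in>V. A e v * x v) = 0"
      using insert.IH[of V A] insert.prems insert.hyps by auto
    then show ?thesis using True by auto
  next
    case False
    then obtain u where u: "u \<in> V" "A e u \<noteq> 0" by blast
    \<comment> \<open>Row \<open>e'\<close> minus the multiple of row \<open>e\<close> that cancels
      column \<open>u\<close>.\<close>
    define A' where "A' e' v = A e' v - A e' u * A e v / A e u" for e' v
    have "card E < card (V - {u})"
      using insert.prems insert.hyps u by simp
    then obtain x where x: "\<exists>v\<in>V - {u}. x v \<noteq> 0"
        "\<forall>e'\<in>E. (\<Sum>v\<in>V - {u}. A' e' v * x v) = 0"
      using insert.IH[of "V - {u}" A'] insert.prems by auto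
    define s where "s = (\<Sum>v\<in>V - {u}. A e v * x v)"
    \<comment> \<open>Back-substitution: the value at \<open>u\<close> is the one that solves
      equation \<open>e\<close>.\<close>
    define y where "y = x(u := - s / A e u)"
    have split: "(\<Sum>v\<in>V. A e' v * y v) = - A e' u * s / A e u + (\<Sum>v\<in>V - {u}. A e' v * x v)" for e'
    proof -
      have "(\<Sum>v\<in>V. A e' v * y v) = A e' u * y u + (\<Sum>v\<in>V - {u}. A e' v * y v)"
        using insert.prems(1) u(1) by (rule sum.remove)
      also have "(\<Sum>v\<in>V - {u}. A e' v * y v) = (\<Sum>v\<in>V - {u}. A e' v * x v)"
        by (rule sum.cong) (auto simp: y_def)
      finally show ?thesis by (simp add: y_def)
    qed
    have "(\<Sum>v\<in>V. A e' v * y v) = 0" if "e' \<in> E" for e'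
    proof -
      have "0 = (\<Sum>v\<in>V - {u}. A' e' v * x v)" using x(2) that by simp
      also have "\<dots> = (\<Sum>v\<in>V - {u}. A e' v * x v - A e' u / A e u * (A e v * x v))"
        by (rule sum.cong) (auto simp: A'_def algebra_simps)
      also have "\<dots> = (\<Sum>v\<in>V - {u}. A e' v * x v) - A e' u / A e u * s"
        by (simp add: sum_subtractf sum_distrib_left s_def)
      finally have "(\<Sum>v\<in>V - {u}. A e' v * x v) = A e' u / A e u * s"
        by (metis eq_iff_diff_eq_0)
      then show ?thesis unfolding split[of e'] by simp
    qed
    moreover have "(\<Sum>v\<in>V. A e v * y v) = 0"
      using split[of e] u(2) by (simp add: s_def)
    moreover have "\<exists>v\<in>V. y v \<noteq> 0"
      using x(1) by (auto simp: y_def)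
    ultimately show ?thesis by blast
  qed
qed

text \<open>Seymour's argument: colour by the sign of a non-trivial vector that sums to zero over every
  block; blocks on which it vanishes are handled recursively.\<close>

lemma two_colouring_of_sparse_blocks:
  assumes "finite V"
    and "\<And>B. B \<in> \<B> \<Longrightarrow> B \<subseteq> V"
    and "\<And>U. U \<subseteq> V \<Longrightarrow> U \<noteq> {} \<Longrightarrow> card {B \<in> \<B>. B \<subseteq> U} < card U"
    and "{} \<notin> \<B>"
  shows "\<exists>q. \<forall>B\<in>\<B>. (\<exists>x\<in>B. q x) \<and> (\<exists>x\<in>B. \<not> q x)"
  using assms
proof (induction V arbitrary: \<B> rule: finite_psubset_induct)
  case (psubset V)
  show ?case
  proof (cases "V = {}")
    case True
    then have "B = {}" if "B \<in> \<B>" for B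
      using psubset.prems(1)[OF that] by simp
    then show ?thesis using psubset.prems(3) by blast
  next
    case False
    have "\<B> \<subseteq> Pow V" using psubset.prems(1) by blast
    then have fB: "finite \<B>" using psubset.hyps finite_subset by blast
    have "{B \<in> \<B>. B \<subseteq> V} = \<B>" using psubset.prems(1) by blast
    then have "card \<B> < card V" using psubset.prems(2)[of V] False by simp
    then obtain x :: "'a \<Rightarrow> real" where x: "\<exists>v\<in>V. x v \<noteq> 0"
      "\<forall>B\<in>\<B>. (\<Sum>v\<in>V. (if v \<in> B then 1 else 0) * x v) = 0"
      using homogeneous_system_nontrivial_solution[OF fB psubset.hyps,
          of "\<lambda>B v. if v \<in> B then 1 else 0"] by blast
    have sum0: "sum x B = 0" if "B \<in> \<B>" for B
    proof -
      have "sum x B = (\<Sum>v\<in>V. if v \<in> B then x v else 0)"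
        using psubset.hyps psubset.prems(1)[OF that]
        by (simp add: sum.inter_restrict[symmetric] Int_absorb1)
      also have "\<dots> = (\<Sum>v\<in>V. (if v \<in> B then 1 else 0) * x v)"
        by (rule sum.cong) auto
      finally show ?thesis using x(2) that by simp
    qed
    define Z where "Z = {v \<in> V. x v = 0}"
    have Z: "Z \<subset> V" using x(1) by (auto simp: Z_def)
    have "\<exists>q. \<forall>B\<in>{B \<in> \<B>. B \<subseteq> Z}. (\<exists>x\<in>B. q x) \<and> (\<exists>x\<in>B. \<not> q x)"
    proof (rule psubset.IH[OF Z])
      fix U assume U: "U \<subseteq> Z" "U \<noteq> {}"
      have "{B \<in> {B \<in> \<B>. B \<subseteq> Z}. B \<subseteq> U} = {B \<in> \<B>. B \<subseteq> U}" using U by blast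
      then show "card {B \<in> {B \<in> \<B>. B \<subseteq> Z}. B \<subseteq> U} < card U"
        using psubset.prems(2)[of U] U Z by auto
    qed (use psubset.prems in auto)
    then obtain q where q: "\<And>B. B \<in> \<B> \<Longrightarrow> B \<subseteq> Z \<Longrightarrow> (\<exists>x\<in>B. q x) \<and> (\<exists>x\<in>B. \<not> q x)"
      by blast
    define q' where "q' v = (if x v = 0 then q v else x v > 0)" for v
    have "(\<exists>v\<in>B. q' v) \<and> (\<exists>v\<in>B. \<not> q' v)" if B: "B \<in> \<B>" for B
    proof (cases "B \<subseteq> Z")
      case True
      then show ?thesis using q[OF B True] by (auto simp: q'_def Z_def)
    next
      case False
      then obtain w where w: "w \<in> B" "x w \<noteq> 0"
        using psubset.prems(1)[OF B] by (auto simp: Z_def)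
      have fin: "finite B"
        using psubset.prems(1)[OF B] psubset.hyps finite_subset by blast
      have "\<exists>v\<in>B. x v > 0"
      proof (rule ccontr)
        assume "\<not> ?thesis"
        then have "\<forall>v\<in>B. 0 \<le> - x v" by auto
        moreover have "(\<Sum>v\<in>B. - x v) = 0" using sum0[OF B] by (simp add: sum_negf)
        ultimately have "\<forall>v\<in>B. - x v = 0" using fin sum_nonneg_eq_0_iff[of B "\<lambda>v. - x v"] by simp
        then show False using w by auto
      qed
      moreover have "\<exists>v\<in>B. x v < 0"
      proof (rule ccontr)
        assume "\<not> ?thesis"
        then have "\<forall>v\<in>B. 0 \<le> x v" by auto
        then have "\<forall>v\<in>B. x v = 0" using fin sum0[OF B] sum_nonneg_eq_0_iff[of B x] by simp
        then show False using w by auto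
      qed
      ultimately obtain a b where ab: "a \<in> B" "x a > 0" "b \<in> B" "x b < 0" by blast
      then have "q' a" "\<not> q' b" by (simp_all add: q'_def)
      then show ?thesis using ab by blast
    qed
    then have "\<forall>B\<in>\<B>. (\<exists>v\<in>B. q' v) \<and> (\<exists>v\<in>B. \<not> q' v)" by simp
    then show ?thesis by (intro exI[of _ q'])
  qed
qed

section \<open>Embeddings\<close>

text \<open>The vertex set and the edge set of the host are separate arguments, so that a colour
  class restricted to a vertex set can be inserted directly.\<close>

definition embeds :: "'a hypergraph \<Rightarrow> 'g set \<Rightarrow> 'g set set \<Rightarrow> bool" where
  "embeds H V E \<longleftrightarrow>
     (\<exists>f. inj_on f (verts H) \<and> f ` verts H \<subseteq> V \<and> (\<forall>e\<in>hedges H. f ` e \<in> E))"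

lemma embeds_mono:
  assumes "embeds H V E" "V \<subseteq> V'" "E \<subseteq> E'"
  shows "embeds H V' E'"
  using assms unfolding embeds_def by (meson subsetD subset_trans)

lemma embeds_of_copy:
  assumes "subhypergraph J G" "isomorphic H J" "hedges J \<subseteq> E"
  shows "embeds H (verts G) E"
proof -
  obtain f where f: "bij_betw f (verts H) (verts J)" "hedges J = (\<lambda>e. f ` e) ` hedges H"
    using assms(2) unfolding isomorphic_def by blast
  have "inj_on f (verts H)" "f ` verts H \<subseteq> verts G"
    using f(1) assms(1) by (auto simp: bij_betw_def subhypergraph_def)
  moreover have "\<forall>e\<in>hedges H. f ` e \<in> E"
    using f(2) assms(3) by auto
  ultimately show ?thesis
    unfolding embeds_def by (intro exI[of _ f]) simp
qed

text \<open>\<open>R\<close> is the set of edges of colour 1. It may contain sets that are not edges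
  of \<open>G\<close>.\<close>

lemma not_arrowsI:
  assumes "\<not> embeds H1 (verts G) R" "\<not> embeds H2 (verts G) (hedges G - R)"
  shows "\<not> arrows G H1 H2"
proof
  assume "arrows G H1 H2"
  define c where "c e = (if e \<in> R then 1 else 2 :: nat)" for e
  have "\<forall>e\<in>hedges G. c e \<in> {1, 2}" by (simp add: c_def)
  then consider J where "subhypergraph J G" "isomorphic H1 J" "\<forall>e\<in>hedges J. c e = 1"
    | J where "subhypergraph J G" "isomorphic H2 J" "\<forall>e\<in>hedges J. c e = 2"
    using \<open>arrows G H1 H2\<close> unfolding arrows_def by blast
  then show False
  proof cases
    case 1
    then have "hedges J \<subseteq> R" by (auto simp: c_def split: if_splits)
    with 1 assms(1) show False using embeds_of_copy by blast
  next
    case 2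
    then have "hedges J \<subseteq> hedges G - R"
      by (auto simp: c_def subhypergraph_def split: if_splits)
    with 2 assms(2) show False using embeds_of_copy by blast
  qed
qed

section \<open>Vertex degrees and copies of a k-graph\<close>

lemma k_graph_finite:
  assumes "k_graph k H"
  shows "finite (verts H)" "finite (hedges H)"
proof -
  show fv: "finite (verts H)" using assms by (simp add: k_graph_def)
  have "hedges H \<subseteq> Pow (verts H)" using assms by (auto simp: k_graph_def)
  then show "finite (hedges H)" using fv finite_subset by blast
qed

lemma k_graph_inj_on_image:
  assumes "k_graph k H" "inj_on f (verts H)"
  shows "inj_on (image f) (hedges H)"
  by (rule inj_on_subset[OF inj_on_image_Pow[OF assms(2)]])
    (use assms(1) in \<open>auto simp: k_graph_def\<close>)

lemma embedding_degree_le: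
  assumes "k_graph k H" "inj_on f (verts H)" "\<forall>e\<in>hedges H. f ` e \<in> E" "finite E"
  shows "card {e \<in> hedges H. x \<in> e} \<le> card {e \<in> E. f x \<in> e}"
  by (rule card_inj_on_le[where f = "image f"])
    (use assms k_graph_inj_on_image[OF assms(1,2)] in \<open>auto intro: inj_on_subset\<close>)

text \<open>A copy of \<open>H\<close> gives each of its vertices degree at least \<open>d\<close>,
  so it cannot use \<open>v\<close>.\<close>

lemma embeds_delete_vertex:
  assumes "k_graph k H" "\<forall>x\<in>verts H. d \<le> card {e \<in> hedges H. x \<in> e}"
    and "finite E" "card {e \<in> E. v \<in> e} < d" "embeds H W E"
  shows "embeds H (W - {v}) {e \<in> E. v \<notin> e}"
proof -
  obtain f where f: "inj_on f (verts H)" "f ` verts H \<subseteq> W" "\<forall>e\<in>hedges H. f ` e \<in> E"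
    using assms(5) unfolding embeds_def by blast
  have v: "v \<noteq> f x" if "x \<in> verts H" for x
    using embedding_degree_le[OF assms(1) f(1,3) assms(3), of x] assms(2,4) that by fastforce
  have "e \<subseteq> verts H" if "e \<in> hedges H" for e
    using that assms(1) by (auto simp: k_graph_def)
  then have "v \<notin> f ` e" if "e \<in> hedges H" for e
    using v that by blast
  with f v show ?thesis unfolding embeds_def by (intro exI[of _ f]) auto
qed

section \<open>Vertex partitions without monochromatic copies\<close>

definition mono_edges :: "'g set set \<Rightarrow> 'g set \<Rightarrow> ('g \<Rightarrow> nat) \<Rightarrow> 'g set set" where
  "mono_edges E W p = {e \<in> E. e \<subseteq> W \<and> (\<exists>i. \<forall>x\<in>e. p x = i)}"

text \<open>The parts are the colour classes of \<open>p\<close> on \<open>W\<close> and may be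
  empty; the edges inside parts are those meant for colour 1.\<close>

definition splits :: "'g set set \<Rightarrow> nat \<Rightarrow> 'a hypergraph \<Rightarrow> 'g set \<Rightarrow> bool" where
  "splits E k H W \<longleftrightarrow> (\<exists>p. (\<forall>x\<in>W. p x < k) \<and> \<not> embeds H W (mono_edges E W p))"

text \<open>Vertices are deleted one by one as long as no good partition appears. The empty set has
  one because \<open>H\<close> has a vertex, so the process stops at a nonempty set.\<close>

lemma splits_minimal:
  assumes "finite V" "\<not> splits E k H V" "verts H \<noteq> {}"
  shows "\<exists>W\<subseteq>V. W \<noteq> {} \<and> \<not> splits E k H W \<and> (\<forall>v\<in>W. splits E k H (W - {v}))"
  using assms(1,2)
proof (induction V rule: finite_psubset_induct)
  case (psubset V)
  have "V \<noteq> {}"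
    using psubset.prems assms(3) by (auto simp: splits_def embeds_def)
  show ?case
  proof (cases "\<forall>v\<in>V. splits E k H (V - {v})")
    case True
    then show ?thesis using psubset.prems \<open>V \<noteq> {}\<close> by blast
  next
    case False
    then obtain v where v: "v \<in> V" "\<not> splits E k H (V - {v})" by blast
    then have "V - {v} \<subset> V" by blast
    from psubset.IH[OF this v(2)] show ?thesis by blast
  qed
qed

text \<open>Describes the effect of extending a partition of \<open>W - {v}\<close> by putting
  \<open>v\<close> into part \<open>i\<close>, separately for edges through \<open>v\<close> and
  edges avoiding it.\<close>

lemma mono_edges_fun_upd:
  shows "{e \<in> mono_edges E W (p(v := i)). v \<in> e} = {e \<in> E. e \<subseteq> W \<and> v \<in> e \<and> (\<forall>x\<in>e - {v}. p x = i)}"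
    and "{e \<in> mono_edges E W (p(v := i)). v \<notin> e} \<subseteq> mono_edges E (W - {v}) p"
proof -
  have "(\<exists>j. \<forall>x\<in>e. (p(v := i)) x = j) \<longleftrightarrow> (\<forall>x\<in>e - {v}. p x = i)" if "v \<in> e" for e
  proof
    assume "\<exists>j. \<forall>x\<in>e. (p(v := i)) x = j"
    then obtain j where j: "\<And>x. x \<in> e \<Longrightarrow> (p(v := i)) x = j" by blast
    show "\<forall>x\<in>e - {v}. p x = i"
    proof
      fix x assume "x \<in> e - {v}"
      then show "p x = i" using j[of x] j[OF that] by simp
    qed
  next
    assume "\<forall>x\<in>e - {v}. p x = i"
    then show "\<exists>j. \<forall>x\<in>e. (p(v := i)) x = j" by (intro exI[of _ i]) simp
  qed
  then show "{e \<in> mono_edges E W (p(v := i)). v \<in> e} = {e \<in> E. e \<subseteq> W \<and> v \<in> e \<and> (\<forall>x\<in>e - {v}. p x = i)}"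
    unfolding mono_edges_def by blast
  have "\<forall>x\<in>e. p x = j" if "v \<notin> e" "\<forall>x\<in>e. (p(v := i)) x = j" for e j
    using that by (metis fun_upd_other)
  then show "{e \<in> mono_edges E W (p(v := i)). v \<notin> e} \<subseteq> mono_edges E (W - {v}) p"
    unfolding mono_edges_def by blast
qed

text \<open>Putting \<open>v\<close> into part \<open>i\<close> must create a copy of
  \<open>H\<close>. If \<open>v\<close> had too few monochromatic edges, this copy would avoid
  \<open>v\<close> and already exist in \<open>W - {v}\<close>.\<close>

lemma not_splits_colour_degree:
  assumes "finite E"
    and "k_graph k H" "\<forall>x\<in>verts H. d \<le> card {e \<in> hedges H. x \<in> e}"
    and "\<not> splits E k H W" "v \<in> W" "i < k"
    and "\<forall>x\<in>W - {v}. p x < k" "\<not> embeds H (W - {v}) (mono_edges E (W - {v}) p)"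
  shows "d \<le> card {e \<in> E. e \<subseteq> W \<and> v \<in> e \<and> (\<forall>x\<in>e - {v}. p x = i)}"
proof (rule ccontr)
  assume "\<not> ?thesis"
  then have lt: "card {e \<in> mono_edges E W (p(v := i)). v \<in> e} < d"
    unfolding mono_edges_fun_upd(1) by simp
  have "\<forall>x\<in>W. (p(v := i)) x < k" using assms(6,7) by simp
  then have emb: "embeds H W (mono_edges E W (p(v := i)))"
    using assms(4) unfolding splits_def by blast
  have "finite (mono_edges E W (p(v := i)))"
    using assms(1) by (simp add: mono_edges_def)
  from embeds_delete_vertex[OF assms(2,3) this lt emb]
  have "embeds H (W - {v}) (mono_edges E (W - {v}) p)"
    by (rule embeds_mono[OF _ order_refl mono_edges_fun_upd(2)])
  then show False using assms(8) by blast
qed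

text \<open>Each of the \<open>k\<close> choices of a part for \<open>v\<close> is blocked by
  \<open>d\<close> edges at \<open>v\<close>, and different choices are blocked by disjoint sets of
  edges.\<close>

lemma minimal_not_splits_degree:
  assumes "\<forall>e\<in>E. card e = k" "k \<ge> 2" "finite E"
    and "k_graph k H" "\<forall>x\<in>verts H. d \<le> card {e \<in> hedges H. x \<in> e}"
    and "\<not> splits E k H W" "v \<in> W" "splits E k H (W - {v})"
  shows "k * d \<le> card {e \<in> E. e \<subseteq> W \<and> v \<in> e}"
proof -
  obtain p where p: "\<forall>x\<in>W - {v}. p x < k" "\<not> embeds H (W - {v}) (mono_edges E (W - {v}) p)"
    using assms(8) unfolding splits_def by blast
  define D where "D i = {e \<in> E. e \<subseteq> W \<and> v \<in> e \<and> (\<forall>x\<in>e - {v}. p x = i)}" for i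
  \<comment> \<open>Gives the disjointness below: a vertex of \<open>e\<close> other than
    \<open>v\<close> determines the part \<open>i\<close> with \<open>e\<close> in
    \<open>D i\<close>.\<close>
  have ne: "e - {v} \<noteq> {}" if "e \<in> E" for e
  proof
    assume "e - {v} = {}"
    then have "card e \<le> 1" using card_mono[of "{v}" e] by auto
    then show False using assms(1,2) that by auto
  qed
  have "k * d = (\<Sum>i<k. d)" by simp
  also have "\<dots> \<le> (\<Sum>i<k. card (D i))"
  proof (rule sum_mono)
    fix i assume "i \<in> {..<k}"
    then have "i < k" by simp
    then show "d \<le> card (D i)"
      unfolding D_def by (rule not_splits_colour_degree[OF assms(3-7) _ p])
  qed
  also have "\<dots> = card (\<Union>i<k. D i)"
  proof (rule card_UN_disjoint[symmetric])
    have "i = j" if "e \<in> D i" "e \<in> D j" for e i j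
    proof -
      have "e \<in> E" using that(1) by (simp add: D_def)
      then obtain x where "x \<in> e - {v}" using ne by blast
      then have "p x = i" "p x = j" using that unfolding D_def by blast+
      then show ?thesis by simp
    qed
    then show "\<forall>i\<in>{..<k}. \<forall>j\<in>{..<k}. i \<noteq> j \<longrightarrow> D i \<inter> D j = {}" by blast
  qed (use assms(3) in \<open>auto simp: D_def\<close>)
  also have "\<dots> \<le> card {e \<in> E. e \<subseteq> W \<and> v \<in> e}"
    using assms(3) by (intro card_mono) (auto simp: D_def)
  finally show ?thesis .
qed

lemma handshake:
  assumes "\<forall>e\<in>E. card e = k" "finite E" "finite W"
  shows "(\<Sum>v\<in>W. card {e \<in> E. e \<subseteq> W \<and> v \<in> e}) = k * card {e \<in> E. e \<subseteq> W}"
proof -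
  have "\<forall>e\<in>{e \<in> E. e \<subseteq> W}. card {v \<in> W. v \<in> e} = k"
  proof
    fix e assume e: "e \<in> {e \<in> E. e \<subseteq> W}"
    then have "{v \<in> W. v \<in> e} = e" by blast
    then show "card {v \<in> W. v \<in> e} = k" using e assms(1) by simp
  qed
  from sum_multicount[OF assms(3) _ this] assms(2) show ?thesis
    by (simp add: conj_assoc)
qed

text \<open>In a minimal \<open>W\<close> without a good partition all degrees are at least
  \<open>k * d\<close>, so \<open>W\<close> spans at least \<open>d * card W\<close> edges, which is
  more than the density bound allows.\<close>

lemma splits_of_min_degree:
  fixes M :: real
  assumes "\<forall>e\<in>E. card e = k" "k \<ge> 2" "finite E" "finite V"
    and "k_graph k H" "\<forall>x\<in>verts H. d \<le> card {e \<in> hedges H. x \<in> e}" "verts H \<noteq> {}"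
    and "\<And>W. W \<subseteq> V \<Longrightarrow> card {e \<in> E. e \<subseteq> W} \<le> M * card W"
    and "M < real d"
  shows "splits E k H V"
proof (rule ccontr)
  assume ns: "\<not> splits E k H V"
  obtain W where W: "W \<subseteq> V" "W \<noteq> {}" "\<not> splits E k H W"
      "\<And>v. v \<in> W \<Longrightarrow> splits E k H (W - {v})"
    using splits_minimal[OF assms(4) ns assms(7)] by blast
  have fW: "finite W" using W(1) assms(4) finite_subset by blast
  have "card W * (k * d) = (\<Sum>v\<in>W. k * d)" by simp
  also have "\<dots> \<le> (\<Sum>v\<in>W. card {e \<in> E. e \<subseteq> W \<and> v \<in> e})"
    by (rule sum_mono) (rule minimal_not_splits_degree[OF assms(1-3,5,6) W(3) _ W(4)])
  finally have "k * (card W * d) \<le> k * card {e \<in> E. e \<subseteq> W}"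
    using handshake[OF assms(1,3) fW] by (simp add: mult_ac)
  then have "card W * d \<le> card {e \<in> E. e \<subseteq> W}" using assms(2) by simp
  then have "real (card W) * real d \<le> real (card {e \<in> E. e \<subseteq> W})"
    by (metis of_nat_le_iff of_nat_mult)
  also have "\<dots> \<le> M * real (card W)" using assms(8)[OF W(1)] .
  finally have "real d \<le> M" using W(2) fW by (simp add: mult.commute card_gt_0_iff)
  then show False using assms(9) by simp
qed

section \<open>Copies on k + 1 vertices and the tight density bound\<close>

lemma uniform_edge_avoiding:
  assumes "finite B" "card B = Suc k" "e \<subseteq> B" "card e = k" "v \<in> B" "v \<notin> e"
  shows "e = B - {v}"
  using assms by (intro card_subset_eq) auto

text \<open>At most one member of \<open>F\<close> avoids \<open>v\<close>, namely
  \<open>B - {v}\<close>.\<close>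

lemma card_edges_le_Suc_degree:
  assumes "finite B" "card B = Suc k" "v \<in> B" "\<forall>e\<in>F. e \<subseteq> B \<and> card e = k"
  shows "card F \<le> Suc (card {e \<in> F. v \<in> e})"
proof -
  have "F \<subseteq> Pow B" using assms(4) by blast
  then have fF: "finite F" using assms(1) finite_subset by blast
  have "e = B - {v}" if "e \<in> F" "v \<notin> e" for e
    using uniform_edge_avoiding[OF assms(1,2)] assms(3,4) that by simp
  then have "F \<subseteq> insert (B - {v}) {e \<in> F. v \<in> e}" by blast
  then have "card F \<le> card (insert (B - {v}) {e \<in> F. v \<in> e})"
    using fF by (intro card_mono) auto
  also have "\<dots> \<le> Suc (card {e \<in> F. v \<in> e})"
    using fF by (intro card_insert_le_m1) auto
  finally show ?thesis .
qed

text \<open>Only \<open>B - {x}\<close> and \<open>B - {y}\<close> can fail to contain both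
  vertices. So if all members of \<open>F\<close> are monochromatic, then \<open>B\<close>
  is.\<close>

lemma common_edge_of_three:
  assumes "finite B" "card B = Suc k" "\<forall>e\<in>F. e \<subseteq> B \<and> card e = k" "3 \<le> card F"
    and "x \<in> B" "y \<in> B"
  shows "\<exists>e\<in>F. x \<in> e \<and> y \<in> e"
proof (rule ccontr)
  assume "\<not> ?thesis"
  then have "e = B - {x} \<or> e = B - {y}" if "e \<in> F" for e
    using uniform_edge_avoiding[OF assms(1,2)] assms(3,5,6) that by metis
  then have "F \<subseteq> {B - {x}, B - {y}}" by blast
  then have "card F \<le> card {B - {x}, B - {y}}" by (intro card_mono) auto
  also have "\<dots> \<le> 2" by (simp add: card_insert_if)
  finally show False using assms(4) by simp
qed

lemma block_of_embedding:
  assumes "k_graph k H" "card (verts H) = Suc k" "card (hedges H) = Suc m" "finite F"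
    and "embeds H W F"
  obtains B where "B \<subseteq> W" "finite B" "card B = Suc k" "Suc m \<le> card {e \<in> F. e \<subseteq> B}"
    "embeds H B {e \<in> F. e \<subseteq> B}"
proof -
  obtain f where f: "inj_on f (verts H)" "f ` verts H \<subseteq> W" "\<forall>e\<in>hedges H. f ` e \<in> F"
    using assms(5) unfolding embeds_def by blast
  define B where "B = f ` verts H"
  have sub: "image f ` hedges H \<subseteq> {e \<in> F. e \<subseteq> B}"
    using f(3) assms(1) by (auto simp: B_def k_graph_def)
  have "card (image f ` hedges H) = Suc m"
    using k_graph_inj_on_image[OF assms(1) f(1)] assms(3) by (simp add: card_image)
  then have "Suc m \<le> card {e \<in> F. e \<subseteq> B}"
    using card_mono[OF _ sub] assms(4) by simp
  moreover have "card B = Suc k" using card_image[OF f(1)] assms(2) by (simp add: B_def)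
  moreover have "finite B" using k_graph_finite(1)[OF assms(1)] by (simp add: B_def)
  moreover have "B \<subseteq> W" using f(2) by (simp add: B_def)
  moreover have "embeds H B {e \<in> F. e \<subseteq> B}"
    unfolding embeds_def using f(1) sub B_def by (intro exI[of _ f]) auto
  ultimately show ?thesis using that by blast
qed

text \<open>In a minimal set without a good partition every vertex v has degree exactly k m, and the k
  copies of H that block the k possible colours of v share no edge, so they use up all edges at v.
  As k is at least 3, the edges at v of any further copy overlap outside v, so this copy has the
  vertex set of one of the k blocking copies. Hence each vertex lies in at most k of the relevant
  (k+1)-sets, which are therefore sparse enough to be 2-coloured.\<close>

lemma splits_of_tight_density:
  assumes E: "\<forall>e\<in>E. card e = k" and k: "k \<ge> 3" and fE: "finite E" and fV: "finite V"
    and H: "k_graph k H" "card (verts H) = Suc k" "card (hedges H) = Suc m" and m: "m \<ge> 2"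
    and dens: "\<And>W. W \<subseteq> V \<Longrightarrow> card {e \<in> E. e \<subseteq> W} \<le> m * card W"
  shows "splits E k H V"
proof (rule ccontr)
  assume ns: "\<not> splits E k H V"
  have k2: "k \<ge> 2" using k by simp
  have ne: "verts H \<noteq> {}" using H(2) by auto
  obtain W where W: "W \<subseteq> V" "W \<noteq> {}" "\<not> splits E k H W"
      "\<And>v. v \<in> W \<Longrightarrow> splits E k H (W - {v})"
    using splits_minimal[OF fV ns ne] by blast
  have fW: "finite W" using W(1) fV finite_subset by blast
  have deg: "\<forall>x\<in>verts H. m \<le> card {e \<in> hedges H. x \<in> e}"
    using card_edges_le_Suc_degree[OF k_graph_finite(1)[OF H(1)] H(2), of _ "hedges H"] H
    by (auto simp: k_graph_def)
  have ge: "k * m \<le> card {e \<in> E. e \<subseteq> W \<and> v \<in> e}" if "v \<in> W" for v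
    by (rule minimal_not_splits_degree[OF E k2 fE H(1) deg W(3) that W(4)[OF that]])
  have "(\<Sum>v\<in>W. card {e \<in> E. e \<subseteq> W \<and> v \<in> e}) \<le> k * (m * card W)"
    using handshake[OF E fE fW] dens[OF W(1)] by simp
  also have "\<dots> = (\<Sum>v\<in>W. k * m)" by simp
  \<comment> \<open>The minimality bound and the density bound meet, which forces equality at every
    vertex.\<close>
  finally have "(\<Sum>v\<in>W. k * m) = (\<Sum>v\<in>W. card {e \<in> E. e \<subseteq> W \<and> v \<in> e})"
    using sum_mono[of W "\<lambda>_. k * m", OF ge] by (intro antisym) auto
  then have regular: "card {e \<in> E. e \<subseteq> W \<and> v \<in> e} = k * m" if "v \<in> W" for v
    using sum_mono_inv[of "\<lambda>_. k * m" W "\<lambda>v. card {e \<in> E. e \<subseteq> W \<and> v \<in> e}" v, OF _ ge that fW]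
    by simp
  \<comment> \<open>These blocks include the vertex sets of all copies of \<open>H\<close> in
    \<open>W\<close>, and they do not depend on any partition.\<close>
  define \<B> where "\<B> = {B. B \<subseteq> W \<and> card B = Suc k \<and> Suc m \<le> card {e \<in> E. e \<subseteq> B}}"
  have fB: "finite B" if "B \<in> \<B>" for B
    using that fW finite_subset by (auto simp: \<B>_def)
  have block: "\<exists>B\<in>\<B>. embeds H B {e \<in> mono_edges E W p. e \<subseteq> B} \<and>
      (\<forall>x\<in>B. \<forall>y\<in>B. \<exists>e\<in>mono_edges E W p. e \<subseteq> B \<and> x \<in> e \<and> y \<in> e)"
    if emb: "embeds H W (mono_edges E W p)" for p
  proof -
    have fin: "finite (mono_edges E W p)" using fE by (simp add: mono_edges_def)
    obtain B where B: "B \<subseteq> W" "finite B" "card B = Suc k"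
        "Suc m \<le> card {e \<in> mono_edges E W p. e \<subseteq> B}" "embeds H B {e \<in> mono_edges E W p. e \<subseteq> B}"
      using block_of_embedding[OF H fin emb] by blast
    have "card {e \<in> mono_edges E W p. e \<subseteq> B} \<le> card {e \<in> E. e \<subseteq> B}"
      using fE by (intro card_mono) (auto simp: mono_edges_def)
    then have "B \<in> \<B>" using B by (simp add: \<B>_def)
    moreover have "\<exists>e\<in>mono_edges E W p. e \<subseteq> B \<and> x \<in> e \<and> y \<in> e" if "x \<in> B" "y \<in> B" for x y
    proof -
      have "\<forall>e\<in>{e \<in> mono_edges E W p. e \<subseteq> B}. e \<subseteq> B \<and> card e = k"
        using E by (simp add: mono_edges_def)
      from common_edge_of_three[OF B(2,3) this _ that] B(4) m show ?thesis by auto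
    qed
    ultimately show ?thesis using B(5) by blast
  qed
  have blocks_at: "card {B \<in> \<B>. v \<in> B} \<le> k" if v: "v \<in> W" for v
  proof -
    obtain p where p: "\<forall>x\<in>W - {v}. p x < k" "\<not> embeds H (W - {v}) (mono_edges E (W - {v}) p)"
      using W(4)[OF v] unfolding splits_def by blast
    have "\<exists>B\<in>\<B>. v \<in> B \<and> (\<forall>x\<in>B - {v}. p x = i)" if i: "i < k" for i
    proof -
      have "\<forall>x\<in>W. (p(v := i)) x < k" using p(1) i by simp
      then have "embeds H W (mono_edges E W (p(v := i)))"
        using W(3) unfolding splits_def by blast
      from block[OF this] obtain B where B: "B \<in> \<B>"
          "embeds H B {e \<in> mono_edges E W (p(v := i)). e \<subseteq> B}"
          "\<And>x y. x \<in> B \<Longrightarrow> y \<in> B \<Longrightarrow> \<exists>e\<in>mono_edges E W (p(v := i)). e \<subseteq> B \<and> x \<in> e \<and> y \<in> e"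
        by blast
      \<comment> \<open>This is where the full embedding into \<open>B\<close> is used: a copy
        avoiding \<open>v\<close> would survive in \<open>W - {v}\<close>, where \<open>p\<close> is
        good.\<close>
      have vB: "v \<in> B"
      proof (rule ccontr)
        assume nv: "v \<notin> B"
        then have "{e \<in> mono_edges E W (p(v := i)). e \<subseteq> B} \<subseteq> {e \<in> mono_edges E W (p(v := i)). v \<notin> e}"
          by blast
        also have "\<dots> \<subseteq> mono_edges E (W - {v}) p" by (rule mono_edges_fun_upd(2))
        finally have "embeds H (W - {v}) (mono_edges E (W - {v}) p)"
          using B(1) nv by (intro embeds_mono[OF B(2)]) (auto simp: \<B>_def)
        then show False using p(2) by simp
      qed
      have "p x = i" if x: "x \<in> B - {v}" for x
      proof -
        obtain e where e: "e \<in> mono_edges E W (p(v := i))" "v \<in> e" "x \<in> e"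
          using B(3)[OF vB, of x] x by blast
        then have "e \<in> {e \<in> mono_edges E W (p(v := i)). v \<in> e}" by simp
        then have "\<forall>x\<in>e - {v}. p x = i" unfolding mono_edges_fun_upd(1) by simp
        then show ?thesis using e(3) x by blast
      qed
      then show ?thesis using B(1) vB by blast
    qed
    then obtain b where b: "\<And>i. i < k \<Longrightarrow> b i \<in> \<B>" "\<And>i. i < k \<Longrightarrow> v \<in> b i"
        "\<And>i x. i < k \<Longrightarrow> x \<in> b i - {v} \<Longrightarrow> p x = i"
      by metis
    define D where "D i = {e \<in> E. e \<subseteq> b i \<and> v \<in> e}" for i
    have degB: "m \<le> card {e \<in> E. e \<subseteq> B \<and> v \<in> e}" if "B \<in> \<B>" "v \<in> B" for B
    proof -
      have "\<forall>e\<in>{e \<in> E. e \<subseteq> B}. e \<subseteq> B \<and> card e = k" using E by simp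
      from card_edges_le_Suc_degree[OF fB[OF that(1)] _ that(2) this] that(1)
      show ?thesis by (simp add: \<B>_def conj_assoc)
    qed
    have disj: "D i \<inter> D j = {}" if ij: "i < k" "j < k" "i \<noteq> j" for i j
    proof (rule ccontr)
      assume "D i \<inter> D j \<noteq> {}"
      then obtain e where e: "e \<in> D i" "e \<in> D j" by blast
      have "\<not> e \<subseteq> {v}"
      proof
        assume "e \<subseteq> {v}"
        then have "card e \<le> 1" using card_mono[of "{v}" e] by simp
        then show False using E k e(1) by (auto simp: D_def)
      qed
      then obtain x where "x \<in> e" "x \<noteq> v" by blast
      then have "x \<in> b i - {v}" "x \<in> b j - {v}" using e by (auto simp: D_def)
      then show False using b(3) ij by metis
    qed
    have sub: "(\<Union>i<k. D i) \<subseteq> {e \<in> E. e \<subseteq> W \<and> v \<in> e}"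
      using b(1) by (fastforce simp: D_def \<B>_def)
    have "k * m = (\<Sum>i<k. m)" by simp
    also have "\<dots> \<le> (\<Sum>i<k. card (D i))"
      using degB b(1,2) by (intro sum_mono) (simp add: D_def)
    also have "\<dots> = card (\<Union>i<k. D i)"
      using disj fE by (intro card_UN_disjoint[symmetric]) (auto simp: D_def)
    \<comment> \<open>There are \<open>k\<close> disjoint families of at least \<open>m\<close>
      edges among exactly \<open>k * m\<close> edges.\<close>
    finally have cover: "(\<Union>i<k. D i) = {e \<in> E. e \<subseteq> W \<and> v \<in> e}"
      using sub fE regular[OF v] by (intro card_seteq) auto
    have "B \<in> b ` {..<k}" if B: "B \<in> \<B>" "v \<in> B" for B
    proof -
      let ?F = "{e \<in> E. e \<subseteq> B \<and> v \<in> e}"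
      have "\<not> card ?F \<le> Suc 0" using degB[OF B] m by simp
      moreover have fF: "finite ?F" using fE by simp
      ultimately have "\<exists>e1\<in>?F. \<exists>e2\<in>?F. e1 \<noteq> e2"
        unfolding card_le_Suc0_iff_eq[OF fF] by simp
      then obtain e1 e2 where e: "e1 \<in> ?F" "e2 \<in> ?F" "e1 \<noteq> e2" by (elim bexE)
      have cB: "card B = Suc k" "B \<subseteq> W" using B(1) by (auto simp: \<B>_def)
      have ce: "card e1 = k" "card e2 = k" using e E by auto
      have fe: "finite e1" "finite e2" using e fB[OF B(1)] finite_subset by auto
      have "\<not> e2 \<subseteq> e1" using e(3) ce fe card_subset_eq by metis
      then have "card e1 < card (e1 \<union> e2)"
        using fe by (intro psubset_card_mono) auto
      then have un: "e1 \<union> e2 = B"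
        using e cB(1) ce fB[OF B(1)] by (intro card_seteq) auto
      have "card (e1 \<union> e2) + card (e1 \<inter> e2) = k + k"
        using card_Un_Int[OF fe] ce by simp
      \<comment> \<open>The intersection has \<open>k - 1\<close> elements, and this is at least 2
        because \<open>k \<ge> 3\<close>. The common vertex \<open>u\<close> other than
        \<open>v\<close> then forces both edges into the same \<open>D i\<close>.\<close>
      then have "card (e1 \<inter> e2) \<ge> 2" using un cB(1) k by simp
      then have "\<not> e1 \<inter> e2 \<subseteq> {v}" using card_mono[of "{v}" "e1 \<inter> e2"] by auto
      then obtain u where u: "u \<in> e1" "u \<in> e2" "u \<noteq> v" by blast
      have "e1 \<in> (\<Union>i<k. D i)" "e2 \<in> (\<Union>i<k. D i)"
        unfolding cover using e cB(2) by auto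
      then obtain i j where ij: "i < k" "j < k" "e1 \<in> D i" "e2 \<in> D j" by blast
      have "u \<in> b i - {v}" "u \<in> b j - {v}" using u ij by (auto simp: D_def)
      then have "i = j" using b(3) ij by metis
      then have "B \<subseteq> b i" using un ij by (auto simp: D_def)
      moreover have "card (b i) = Suc k" using b(1)[OF ij(1)] by (simp add: \<B>_def)
      ultimately have "B = b i"
        using cB(1) fB[OF b(1)[OF ij(1)]] by (intro card_subset_eq) auto
      then show ?thesis using ij(1) by blast
    qed
    then have "{B \<in> \<B>. v \<in> B} \<subseteq> b ` {..<k}" by blast
    then have "card {B \<in> \<B>. v \<in> B} \<le> card (b ` {..<k})" by (intro card_mono) auto
    also have "\<dots> \<le> k" using card_image_le[of "{..<k}" b] by simp
    finally show ?thesis .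
  qed
  have "\<B> \<subseteq> Pow W" by (auto simp: \<B>_def)
  then have fin\<B>: "finite \<B>" using fW finite_subset by blast
  \<comment> \<open>Double counting: a block has \<open>k + 1\<close> vertices, but a vertex lies in
    at most \<open>k\<close> blocks.\<close>
  have sparse: "card {B \<in> \<B>. B \<subseteq> U} < card U" if U: "U \<subseteq> W" "U \<noteq> {}" for U
  proof -
    have fU: "finite U" using U(1) fW finite_subset by blast
    have "Suc k * card {B \<in> \<B>. B \<subseteq> U} = (\<Sum>v\<in>U. card {B \<in> \<B>. B \<subseteq> U \<and> v \<in> B})"
      by (rule handshake[symmetric]) (use fin\<B> fU in \<open>auto simp: \<B>_def\<close>)
    also have "\<dots> \<le> (\<Sum>v\<in>U. k)"
    proof (rule sum_mono)
      fix v assume "v \<in> U"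
      have "card {B \<in> \<B>. B \<subseteq> U \<and> v \<in> B} \<le> card {B \<in> \<B>. v \<in> B}"
        using fin\<B> by (intro card_mono) auto
      also have "\<dots> \<le> k" using blocks_at \<open>v \<in> U\<close> U(1) by blast
      finally show "card {B \<in> \<B>. B \<subseteq> U \<and> v \<in> B} \<le> k" .
    qed
    also have "\<dots> = k * card U" by simp
    also have "\<dots> < Suc k * card U" using U(2) fU by (simp add: card_gt_0_iff)
    finally show ?thesis by (simp only: mult_less_cancel1)
  qed
  have "{} \<notin> \<B>" by (auto simp: \<B>_def)
  then have "\<exists>q. \<forall>B\<in>\<B>. (\<exists>x\<in>B. q x) \<and> (\<exists>x\<in>B. \<not> q x)"
    using sparse by (intro two_colouring_of_sparse_blocks[OF fW]) (auto simp: \<B>_def)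
  then obtain q where q: "\<forall>B\<in>\<B>. (\<exists>x\<in>B. q x) \<and> (\<exists>x\<in>B. \<not> q x)" by (elim exE)
  \<comment> \<open>Two of the \<open>k\<close> parts suffice, since no block is monochromatic under
    \<open>q\<close>.\<close>
  define p :: "'a \<Rightarrow> nat" where "p x = (if q x then 0 else 1)" for x
  have "\<forall>x\<in>W. p x < k" using k by (simp add: p_def)
  then have "embeds H W (mono_edges E W p)" using W(3) unfolding splits_def by blast
  from block[OF this] obtain B where B: "B \<in> \<B>"
      "\<And>x y. x \<in> B \<Longrightarrow> y \<in> B \<Longrightarrow> \<exists>e\<in>mono_edges E W p. e \<subseteq> B \<and> x \<in> e \<and> y \<in> e"
    by blast
  obtain x y where xy: "x \<in> B" "y \<in> B" "q x" "\<not> q y" using q B(1) by blast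
  obtain e where "e \<in> mono_edges E W p" "x \<in> e" "y \<in> e" using B(2)[OF xy(1,2)] by blast
  then have "p x = p y" by (auto simp: mono_edges_def)
  then show False using xy by (simp add: p_def)
qed

section \<open>Colourings from bounded edge assignments\<close>

lemma embeds_edge_count:
  assumes "k_graph k H" "finite F" "embeds H V F"
  shows "\<exists>X\<subseteq>V. finite X \<and> card X = card (verts H) \<and> card (hedges H) \<le> card {e \<in> F. e \<subseteq> X}"
proof -
  obtain f where f: "inj_on f (verts H)" "f ` verts H \<subseteq> V" "\<forall>e\<in>hedges H. f ` e \<in> F"
    using assms(3) unfolding embeds_def by blast
  have "image f ` hedges H \<subseteq> {e \<in> F. e \<subseteq> f ` verts H}"
    using f(3) assms(1) by (auto simp: k_graph_def)
  then have "card (image f ` hedges H) \<le> card {e \<in> F. e \<subseteq> f ` verts H}"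
    using assms(2) by (intro card_mono) auto
  moreover have "card (image f ` hedges H) = card (hedges H)"
    using k_graph_inj_on_image[OF assms(1) f(1)] by (rule card_image)
  ultimately show ?thesis
    using f(2) card_image[OF f(1)] k_graph_finite(1)[OF assms(1)]
    by (intro exI[of _ "f ` verts H"]) simp
qed

lemma embeds_subhypergraph:
  assumes "embeds H V F" "subhypergraph J H"
  shows "embeds J V F"
proof -
  obtain f where f: "inj_on f (verts H)" "f ` verts H \<subseteq> V" "\<forall>e\<in>hedges H. f ` e \<in> F"
    using assms(1) unfolding embeds_def by blast
  moreover have "verts J \<subseteq> verts H" "hedges J \<subseteq> hedges H"
    using assms(2) by (auto simp: subhypergraph_def)
  ultimately show ?thesis
    unfolding embeds_def by (intro exI[of _ f]) (auto intro: inj_on_subset)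
qed

lemma k_graph_subhypergraph:
  assumes "k_graph k H" "subhypergraph J H"
  shows "k_graph k J"
  using assms finite_subset unfolding k_graph_def subhypergraph_def by blast

text \<open>Every edge inside \<open>X\<close> is assigned to a vertex of \<open>X\<close>.\<close>

lemma card_edges_le_load:
  assumes "finite F" "finite X" "\<forall>e\<in>F. a e \<in> e"
    and "\<And>v. v \<in> X \<Longrightarrow> card {e \<in> F. a e = v} \<le> c"
  shows "card {e \<in> F. e \<subseteq> X} \<le> c * card X"
proof -
  have "{e \<in> F. e \<subseteq> X} \<subseteq> (\<Union>v\<in>X. {e \<in> F. a e = v})" using assms(3) by blast
  then have "card {e \<in> F. e \<subseteq> X} \<le> card (\<Union>v\<in>X. {e \<in> F. a e = v})"
    using assms(1,2) by (intro card_mono) auto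
  also have "\<dots> \<le> (\<Sum>v\<in>X. card {e \<in> F. a e = v})" using assms(2) by (rule card_UN_le)
  also have "\<dots> \<le> (\<Sum>v\<in>X. c)" by (rule sum_mono) (rule assms(4))
  finally show ?thesis by (simp add: mult.commute)
qed

text \<open>Assign at most \<open>q\<close> edges to each vertex and give up to \<open>b\<close> of
  them colour 2, so at most \<open>q - b\<close> keep colour 1. Then a vertex set \<open>X\<close>
  spans at most \<open>b * card X\<close> edges of colour 2, too few for \<open>J\<close>, and at
  most \<open>(q - b) * card X\<close> of colour 1, too few for \<open>H1\<close>. The truncated
  difference is right when \<open>q \<le> b\<close>, as colour 1 is then empty.\<close>

lemma not_arrows_by_orientation:
  assumes "k_graph k G" "k_graph k H1" "k_graph k H2"
    and dens: "\<And>W. W \<subseteq> verts G \<Longrightarrow> card {e \<in> hedges G. e \<subseteq> W} \<le> q * card W"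
    and H1: "(q - b) * card (verts H1) < card (hedges H1)"
    and J: "subhypergraph J H2" "b * card (verts J) < card (hedges J)"
  shows "\<not> arrows G H1 H2"
proof -
  note fin = k_graph_finite[OF assms(1)]
  have "\<exists>a. (\<forall>e\<in>hedges G. a e \<in> e) \<and> (\<forall>v. v \<in> verts G \<longrightarrow> card {e \<in> hedges G. a e = v} \<le> q)"
  proof (rule exists_orientation[OF fin(2,1)])
    show "e \<subseteq> verts G" if "e \<in> hedges G" for e using that assms(1) by (auto simp: k_graph_def)
    show "card {e \<in> hedges G. e \<subseteq> W} \<le> (\<Sum>v\<in>W. q)" if "W \<subseteq> verts G" for W
      using dens[OF that] by (simp add: mult.commute)
  qed
  then obtain a where a: "\<forall>e\<in>hedges G. a e \<in> e"
      "\<And>v. v \<in> verts G \<Longrightarrow> card {e \<in> hedges G. a e = v} \<le> q"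
    by blast
  define S where "S v = {e \<in> hedges G. a e = v}" for v
  have "\<exists>B\<subseteq>S v. card B = min b (card (S v))" for v
    by (metis min.cobounded2 obtain_subset_with_card_n)
  then obtain B where B: "\<And>v. B v \<subseteq> S v" "\<And>v. card (B v) = min b (card (S v))" by metis
  have fS: "finite (S v)" for v using fin by (simp add: S_def)
  define R where "R = {e \<in> hedges G. e \<notin> B (a e)}"
  have "\<not> embeds H1 (verts G) R"
  proof
    assume "embeds H1 (verts G) R"
    from embeds_edge_count[OF assms(2) _ this] fin(2) obtain X where X: "X \<subseteq> verts G" "finite X"
        "card X = card (verts H1)" "card (hedges H1) \<le> card {e \<in> R. e \<subseteq> X}"
      by (auto simp: R_def)
    have "card {e \<in> R. a e = v} \<le> q - b" if "v \<in> X" for v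
    proof -
      have "{e \<in> R. a e = v} = S v - B v" by (auto simp: R_def S_def)
      then have "card {e \<in> R. a e = v} = card (S v) - card (B v)"
        using card_Diff_subset[OF finite_subset[OF B(1) fS] B(1)] by simp
      moreover have "card (S v) \<le> q" using a(2) that X(1) by (auto simp: S_def)
      ultimately show ?thesis using B(2)[of v] by simp
    qed
    then have "card {e \<in> R. e \<subseteq> X} \<le> (q - b) * card X"
      using fin a(1) X(2) by (intro card_edges_le_load[where a = a]) (auto simp: R_def)
    then show False using X(3,4) H1 by simp
  qed
  moreover have "\<not> embeds H2 (verts G) (hedges G - R)"
  proof
    assume "embeds H2 (verts G) (hedges G - R)"
    then have "embeds J (verts G) (hedges G - R)" using J(1) by (rule embeds_subhypergraph)
    from embeds_edge_count[OF k_graph_subhypergraph[OF assms(3) J(1)] _ this] fin(2)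
    obtain X where X: "X \<subseteq> verts G" "finite X"
        "card X = card (verts J)" "card (hedges J) \<le> card {e \<in> hedges G - R. e \<subseteq> X}"
      by auto
    have "card {e \<in> hedges G - R. a e = v} \<le> b" for v
    proof -
      have "{e \<in> hedges G - R. a e = v} \<subseteq> B v" by (auto simp: R_def)
      then have "card {e \<in> hedges G - R. a e = v} \<le> card (B v)"
        by (rule card_mono[OF finite_subset[OF B(1) fS]])
      then show ?thesis using B(2)[of v] by simp
    qed
    then have "card {e \<in> hedges G - R. e \<subseteq> X} \<le> b * card X"
      using fin a(1) X(2) by (intro card_edges_le_load[where a = a]) auto
    then show False using X(3,4) J(2) by simp
  qed
  ultimately show ?thesis by (rule not_arrowsI)
qed

section \<open>Triangles in graphs of maximum density two\<close>

text \<open>Three vertices have only three pairs, so \<open>H\<close> is a triangle.\<close>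

lemma embeds_triangle_iff:
  assumes "k_graph 2 H" "card (verts H) = 3" "card (hedges H) = 3"
  shows "embeds H V F \<longleftrightarrow> (\<exists>x\<in>V. \<exists>y\<in>V. \<exists>z\<in>V. x \<noteq> y \<and> y \<noteq> z \<and> x \<noteq> z \<and>
    {x, y} \<in> F \<and> {y, z} \<in> F \<and> {x, z} \<in> F)"
proof -
  obtain a b c where abc: "verts H = {a, b, c}" "a \<noteq> b" "b \<noteq> c" "a \<noteq> c"
    using assms(2) by (auto simp: card_3_iff)
  have "e \<in> {{a, b}, {b, c}, {a, c}}" if "e \<in> hedges H" for e
  proof -
    have "e \<subseteq> {a, b, c}" "card e = 2" using that assms(1) abc(1) by (auto simp: k_graph_def)
    then obtain x y where "e = {x, y}" "x \<noteq> y" "x \<in> {a, b, c}" "y \<in> {a, b, c}"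
      by (auto simp: card_2_iff)
    then show ?thesis by auto
  qed
  then have sub: "hedges H \<subseteq> {{a, b}, {b, c}, {a, c}}" by blast
  moreover have "card {{a, b}, {b, c}, {a, c}} = 3"
    using abc by (auto simp: doubleton_eq_iff card_insert_if)
  ultimately have ed: "hedges H = {{a, b}, {b, c}, {a, c}}"
    using assms(3) by (intro card_subset_eq) auto
  show ?thesis
  proof
    assume "embeds H V F"
    then obtain f where f: "inj_on f (verts H)" "f ` verts H \<subseteq> V" "\<forall>e\<in>hedges H. f ` e \<in> F"
      unfolding embeds_def by blast
    have "f a \<in> V" "f b \<in> V" "f c \<in> V" using f(2) abc(1) by auto
    moreover have "f a \<noteq> f b" "f b \<noteq> f c" "f a \<noteq> f c"
      using f(1) abc by (auto simp: inj_on_def)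
    moreover have "{f a, f b} \<in> F" "{f b, f c} \<in> F" "{f a, f c} \<in> F"
      using f(3) ed by auto
    ultimately show "\<exists>x\<in>V. \<exists>y\<in>V. \<exists>z\<in>V. x \<noteq> y \<and> y \<noteq> z \<and> x \<noteq> z \<and>
        {x, y} \<in> F \<and> {y, z} \<in> F \<and> {x, z} \<in> F" by blast
  next
    assume "\<exists>x\<in>V. \<exists>y\<in>V. \<exists>z\<in>V. x \<noteq> y \<and> y \<noteq> z \<and> x \<noteq> z \<and>
        {x, y} \<in> F \<and> {y, z} \<in> F \<and> {x, z} \<in> F"
    then obtain x y z where xyz: "x \<in> V" "y \<in> V" "z \<in> V" "x \<noteq> y" "y \<noteq> z" "x \<noteq> z"
        "{x, y} \<in> F" "{y, z} \<in> F" "{x, z} \<in> F"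
      by blast
    define f where "f t = (if t = a then x else if t = b then y else z)" for t
    have "inj_on f (verts H)" "f ` verts H \<subseteq> V"
      using abc xyz by (auto simp: inj_on_def f_def)
    moreover have "\<forall>e\<in>hedges H. f ` e \<in> F"
      unfolding ed using abc xyz by (auto simp: f_def insert_commute)
    ultimately show "embeds H V F" unfolding embeds_def by blast
  qed
qed

text \<open>The average degree inside \<open>V\<close> is at most 4.\<close>

lemma low_degree_neighbourhood:
  assumes "\<forall>e\<in>E. card e = 2" "finite E" "finite V" "V \<noteq> {}"
    and "card {e \<in> E. e \<subseteq> V} \<le> 2 * card V"
  obtains v where "v \<in> V" "card {x \<in> V - {v}. {v, x} \<in> E} \<le> 4"
proof -
  have "\<exists>v\<in>V. card {e \<in> E. e \<subseteq> V \<and> v \<in> e} \<le> 4"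
  proof (rule ccontr)
    assume "\<not> ?thesis"
    then have "5 \<le> card {e \<in> E. e \<subseteq> V \<and> v \<in> e}" if "v \<in> V" for v
      using that by fastforce
    then have "(\<Sum>v\<in>V. 5) \<le> (\<Sum>v\<in>V. card {e \<in> E. e \<subseteq> V \<and> v \<in> e})"
      by (rule sum_mono)
    then have "5 * card V \<le> 4 * card V"
      using handshake[OF assms(1-3)] assms(5) by simp
    then show False using assms(3,4) by (simp add: card_gt_0_iff)
  qed
  then obtain v where v: "v \<in> V" "card {e \<in> E. e \<subseteq> V \<and> v \<in> e} \<le> 4" by blast
  have "card {x \<in> V - {v}. {v, x} \<in> E} \<le> card {e \<in> E. e \<subseteq> V \<and> v \<in> e}"
    by (rule card_inj_on_le[where f = "\<lambda>x. {v, x}"])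
      (use v(1) assms(2) in \<open>auto simp: inj_on_def doubleton_eq_iff\<close>)
  then show ?thesis using v that by auto
qed

text \<open>Greedy colouring: a vertex with at most four neighbours is coloured last, and one of the
  five colours is free for it.\<close>

lemma sparse_graph_five_colouring:
  assumes "\<forall>e\<in>E. card e = 2" "finite E" "finite V"
    and "\<And>W. W \<subseteq> V \<Longrightarrow> card {e \<in> E. e \<subseteq> W} \<le> 2 * card W"
  shows "\<exists>p. (\<forall>x\<in>V. p x < (5::nat)) \<and> (\<forall>x\<in>V. \<forall>y\<in>V. x \<noteq> y \<longrightarrow> {x, y} \<in> E \<longrightarrow> p x \<noteq> p y)"
  using assms(3,4)
proof (induction V rule: finite_psubset_induct)
  case (psubset V)
  show ?case
  proof (cases "V = {}")
    case True
    then show ?thesis by simp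
  next
    case False
    obtain v where v: "v \<in> V" "card {x \<in> V - {v}. {v, x} \<in> E} \<le> 4"
      using low_degree_neighbourhood[OF assms(1,2) psubset.hyps False psubset.prems[OF order_refl]]
      by blast
    define N where "N = {x \<in> V - {v}. {v, x} \<in> E}"
    have "V - {v} \<subset> V" using v(1) by blast
    moreover have "card {e \<in> E. e \<subseteq> W} \<le> 2 * card W" if "W \<subseteq> V - {v}" for W
      using psubset.prems[of W] that by blast
    ultimately have "\<exists>p. (\<forall>x\<in>V - {v}. p x < (5::nat)) \<and>
        (\<forall>x\<in>V - {v}. \<forall>y\<in>V - {v}. x \<noteq> y \<longrightarrow> {x, y} \<in> E \<longrightarrow> p x \<noteq> p y)"
      by (rule psubset.IH)
    then obtain p where p: "\<And>x. x \<in> V - {v} \<Longrightarrow> p x < (5::nat)"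
        "\<And>x y. x \<in> V - {v} \<Longrightarrow> y \<in> V - {v} \<Longrightarrow> x \<noteq> y \<Longrightarrow> {x, y} \<in> E \<Longrightarrow> p x \<noteq> p y"
      by blast
    have fN: "finite N" using psubset.hyps by (simp add: N_def)
    have "card (p ` N) < card {..<5::nat}"
      using card_image_le[OF fN, of p] v(2) by (simp add: N_def)
    then have "\<not> {..<5} \<subseteq> p ` N"
      using card_mono[of "p ` N" "{..<5}"] fN by auto
    then obtain i where i: "i < 5" "i \<notin> p ` N" by blast
    have "(p(v := i)) x \<noteq> (p(v := i)) y" if xy: "x \<in> V" "y \<in> V" "x \<noteq> y" "{x, y} \<in> E" for x y
    proof -
      consider "x = v" | "y = v" | "x \<noteq> v" "y \<noteq> v" by blast
      then show ?thesis
      proof cases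
        case 1
        then have "y \<in> N" using xy by (simp add: N_def)
        then show ?thesis using i(2) xy 1 by auto
      next
        case 2
        then have "x \<in> N" using xy by (simp add: N_def insert_commute)
        then show ?thesis using i(2) xy 2 by auto
      next
        case 3
        then show ?thesis using p(2)[of x y] xy by simp
      qed
    qed
    moreover have "\<forall>x\<in>V. (p(v := i)) x < 5" using p(1) i(1) by simp
    ultimately show ?thesis by blast
  qed
qed

text \<open>The edges of the complete graph on five vertices split into two pentagons, which are
  triangle-free; this colouring is pulled back along a proper 5-colouring.\<close>

lemma two_triangle_free_parts:
  assumes "\<forall>e\<in>E. card e = 2" "finite E" "finite V"
    and "\<And>W. W \<subseteq> V \<Longrightarrow> card {e \<in> E. e \<subseteq> W} \<le> 2 * card W"
    and "k_graph 2 H1" "card (verts H1) = 3" "card (hedges H1) = 3"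
    and "k_graph 2 H2" "card (verts H2) = 3" "card (hedges H2) = 3"
  shows "\<exists>R. \<not> embeds H1 V R \<and> \<not> embeds H2 V (E - R)"
proof -
  obtain p where p: "\<And>x. x \<in> V \<Longrightarrow> p x < (5::nat)"
      "\<And>x y. x \<in> V \<Longrightarrow> y \<in> V \<Longrightarrow> x \<noteq> y \<Longrightarrow> {x, y} \<in> E \<Longrightarrow> p x \<noteq> p y"
    using sparse_graph_five_colouring[OF assms(1-4)] by blast
  \<comment> \<open>Adjacency in the pentagon on the residues modulo 5; distinct non-adjacent
    residues form the other pentagon.\<close>
  define adj where "adj i j \<longleftrightarrow> j = (i + 1) mod 5 \<or> i = (j + 1) mod (5::nat)" for i j
  define R where "R = {e. \<exists>x y. e = {x, y} \<and> adj (p x) (p y)}"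
  have R: "{x, y} \<in> R \<longleftrightarrow> adj (p x) (p y)" for x y
    by (auto simp: R_def doubleton_eq_iff adj_def)
  have less5: "i = 0 \<or> i = 1 \<or> i = 2 \<or> i = 3 \<or> i = 4" if "i < 5" for i :: nat
    using that by linarith
  have no_red: False if "i < 5" "j < 5" "k < 5" "adj i j" "adj j k" "adj i k" for i j k
    using less5[OF that(1)] less5[OF that(2)] less5[OF that(3)] that(4-6)
    by (elim disjE; simp add: adj_def)
  have no_blue: False if "i < 5" "j < 5" "k < 5" "i \<noteq> j" "j \<noteq> k" "i \<noteq> k"
      "\<not> adj i j" "\<not> adj j k" "\<not> adj i k" for i j k
    using less5[OF that(1)] less5[OF that(2)] less5[OF that(3)] that(4-9)
    by (elim disjE; simp add: adj_def)
  have "\<not> embeds H1 V R"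
    unfolding embeds_triangle_iff[OF assms(5-7)] R using no_red p(1) by metis
  moreover have "\<not> embeds H2 V (E - R)"
    unfolding embeds_triangle_iff[OF assms(8-10)] Diff_iff R using no_blue p by metis
  ultimately show ?thesis by blast
qed

text \<open>The vertices are added one at a time. A new vertex v, chosen last, has at most four
  neighbours, not all joined in colour 1. So at most two edges at v, whose other ends are not joined
  in colour 1, can be given colour 1 such that at most two edges at v remain for colour 2.\<close>

lemma triangle_versus_min_degree_three:
  assumes "\<forall>e\<in>E. card e = 2" "finite E" "finite V"
    and "\<And>W. W \<subseteq> V \<Longrightarrow> card {e \<in> E. e \<subseteq> W} \<le> 2 * card W"
    and H1: "k_graph 2 H1" "card (verts H1) = 3" "card (hedges H1) = 3"
    and H2: "k_graph 2 H2" "\<forall>x\<in>verts H2. 3 \<le> card {e \<in> hedges H2. x \<in> e}" "verts H2 \<noteq> {}"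
  shows "\<exists>R\<subseteq>{e \<in> E. e \<subseteq> V}. \<not> embeds H1 V R \<and> \<not> embeds H2 V ({e \<in> E. e \<subseteq> V} - R)"
  using assms(3,4)
proof (induction V rule: finite_psubset_induct)
  case (psubset V)
  show ?case
  proof (cases "V = {}")
    case True
    have "verts H1 \<noteq> {}" using H1(2) by auto
    then show ?thesis using True H2(3) by (intro exI[of _ "{}"]) (auto simp: embeds_def)
  next
    case False
    obtain v where v: "v \<in> V" "card {x \<in> V - {v}. {v, x} \<in> E} \<le> 4"
      using low_degree_neighbourhood[OF assms(1,2) psubset.hyps False psubset.prems[OF order_refl]]
      by blast
    define N where "N = {x \<in> V - {v}. {v, x} \<in> E}"
    have fN: "finite N" using psubset.hyps by (simp add: N_def)
    have "V - {v} \<subset> V" using v(1) by blast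
    moreover have "card {e \<in> E. e \<subseteq> W} \<le> 2 * card W" if "W \<subseteq> V - {v}" for W
      using psubset.prems[of W] that by blast
    ultimately have "\<exists>R\<subseteq>{e \<in> E. e \<subseteq> V - {v}}. \<not> embeds H1 (V - {v}) R \<and>
        \<not> embeds H2 (V - {v}) ({e \<in> E. e \<subseteq> V - {v}} - R)"
      by (rule psubset.IH)
    then obtain R0 where R0: "R0 \<subseteq> {e \<in> E. e \<subseteq> V - {v}}" "\<not> embeds H1 (V - {v}) R0"
        "\<not> embeds H2 (V - {v}) ({e \<in> E. e \<subseteq> V - {v}} - R0)"
      by blast
    \<comment> \<open>\<open>S\<close> collects the neighbours joined to \<open>v\<close> in colour
      1. With at most three neighbours a set of size at most 1 suffices. With four, among any three
      of them some pair is outside \<open>R0\<close>, since \<open>R0\<close> has no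
      triangle.\<close>
    have "\<exists>S\<subseteq>N. card (N - S) \<le> 2 \<and> (\<forall>x\<in>S. \<forall>y\<in>S. x \<noteq> y \<longrightarrow> {x, y} \<notin> R0)"
    proof (cases "card N \<le> 3")
      case True
      obtain S where S: "S \<subseteq> N" "card S = card N - 2"
        using obtain_subset_with_card_n[of "card N - 2" N] by auto
      have fS: "finite S" using S(1) fN finite_subset by blast
      have "card (N - S) \<le> 2" using card_Diff_subset[OF fS S(1)] S(2) by simp
      moreover have "\<forall>x\<in>S. \<forall>y\<in>S. x = y"
        unfolding card_le_Suc0_iff_eq[OF fS, symmetric] using S(2) True by simp
      ultimately show ?thesis using S(1) by blast
    next
      case False
      then have N4: "card N = 4" using v(2) by (simp add: N_def)
      obtain T where T: "T \<subseteq> N" "card T = 3"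
        using obtain_subset_with_card_n[of 3 N] N4 by auto
      then obtain x y z where xyz: "T = {x, y, z}" "x \<noteq> y" "y \<noteq> z" "x \<noteq> z"
        by (auto simp: card_3_iff)
      then have "x \<in> V - {v}" "y \<in> V - {v}" "z \<in> V - {v}" using T(1) by (auto simp: N_def)
      then have "\<not> ({x, y} \<in> R0 \<and> {y, z} \<in> R0 \<and> {x, z} \<in> R0)"
        using R0(2) xyz(2-4) unfolding embeds_triangle_iff[OF H1] by blast
      then obtain s t where st: "s \<in> T" "t \<in> T" "s \<noteq> t" "{s, t} \<notin> R0"
        unfolding xyz(1) using xyz(2-4) by blast
      have "card (N - {s, t}) = 2"
        using N4 st T(1) by (subst card_Diff_subset) auto
      moreover have "\<forall>x\<in>{s, t}. \<forall>y\<in>{s, t}. x \<noteq> y \<longrightarrow> {x, y} \<notin> R0"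
        using st(4) by (simp add: insert_commute)
      ultimately show ?thesis using st(1,2) T(1) by (intro exI[of _ "{s, t}"]) auto
    qed
    then obtain S where S: "S \<subseteq> N" "card (N - S) \<le> 2"
        "\<And>x y. x \<in> S \<Longrightarrow> y \<in> S \<Longrightarrow> x \<noteq> y \<Longrightarrow> {x, y} \<notin> R0"
      by blast
    define R where "R = R0 \<union> (\<lambda>x. {v, x}) ` S"
    have R_v: "x \<in> S" if "{v, x} \<in> R" "x \<noteq> v" for x
      using that R0(1) by (auto simp: R_def doubleton_eq_iff)
    have R_nv: "{x, y} \<in> R0" if "{x, y} \<in> R" "x \<noteq> v" "y \<noteq> v" for x y
      using that by (auto simp: R_def doubleton_eq_iff)
    have no_triangle: False if "{v, x} \<in> R" "{v, y} \<in> R" "{x, y} \<in> R" "x \<noteq> v" "y \<noteq> v" "x \<noteq> y" for x y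
      using S(3)[OF R_v[OF that(1,4)] R_v[OF that(2,5)] that(6)] R_nv[OF that(3-5)] by simp
    have "\<not> embeds H1 V R"
    proof
      assume "embeds H1 V R"
      then obtain x y z where xyz: "x \<in> V" "y \<in> V" "z \<in> V" "x \<noteq> y" "y \<noteq> z" "x \<noteq> z"
          "{x, y} \<in> R" "{y, z} \<in> R" "{x, z} \<in> R"
        unfolding embeds_triangle_iff[OF H1] by blast
      consider "x = v" | "y = v" | "z = v" | "x \<noteq> v" "y \<noteq> v" "z \<noteq> v" by blast
      then show False
      proof cases
        case 1
        then show ?thesis using no_triangle[of y z] xyz by auto
      next
        case 2
        then show ?thesis using no_triangle[of x z] xyz by (auto simp: insert_commute)
      next
        case 3
        then show ?thesis using no_triangle[of x y] xyz by (auto simp: insert_commute)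
      next
        case 4
        then have "embeds H1 (V - {v}) R0"
          unfolding embeds_triangle_iff[OF H1]
          using xyz R_nv[of x y] R_nv[of y z] R_nv[of x z] by blast
        then show ?thesis using R0(2) by simp
      qed
    qed
    moreover have "\<not> embeds H2 V ({e \<in> E. e \<subseteq> V} - R)"
    proof
      let ?B = "{e \<in> E. e \<subseteq> V} - R"
      assume emb: "embeds H2 V ?B"
      have "e \<in> (\<lambda>x. {v, x}) ` (N - S)" if e: "e \<in> ?B" "v \<in> e" for e
      proof -
        have "card e = 2" using e(1) assms(1) by simp
        then obtain x where x: "e = {v, x}" "x \<noteq> v"
          using e(2) by (auto simp: card_2_iff)
        then show ?thesis using e by (auto simp: N_def R_def)
      qed
      then have "{e \<in> ?B. v \<in> e} \<subseteq> (\<lambda>x. {v, x}) ` (N - S)" by blast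
      then have "card {e \<in> ?B. v \<in> e} \<le> card ((\<lambda>x. {v, x}) ` (N - S))"
        using fN by (intro card_mono) auto
      also have "\<dots> \<le> card (N - S)" using fN by (intro card_image_le) simp
      \<comment> \<open>Below the minimum degree of \<open>H2\<close>, so a copy of
        \<open>H2\<close> in colour 2 avoids \<open>v\<close>.\<close>
      finally have "card {e \<in> ?B. v \<in> e} < 3" using S(2) by simp
      from embeds_delete_vertex[OF H2(1,2) _ this emb] assms(2)
      have "embeds H2 (V - {v}) {e \<in> ?B. v \<notin> e}" by simp
      moreover have "{e \<in> ?B. v \<notin> e} \<subseteq> {e \<in> E. e \<subseteq> V - {v}} - R0" by (auto simp: R_def)
      ultimately have "embeds H2 (V - {v}) ({e \<in> E. e \<subseteq> V - {v}} - R0)"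
        by (rule embeds_mono[OF _ order_refl])
      then show False using R0(3) by simp
    qed
    moreover have "R \<subseteq> {e \<in> E. e \<subseteq> V}"
      using R0(1) S(1) v(1) by (auto simp: R_def N_def)
    ultimately show ?thesis by blast
  qed
qed

section \<open>Densities of hearts\<close>

text \<open>Stated for an arbitrary \<open>d\<close>, to serve \<open>max_dens\<close>,
  \<open>max_k_dens\<close> and \<open>max_asym_dens\<close> alike.\<close>

lemma Max_over_subhypergraphs:
  fixes d :: "'a hypergraph \<Rightarrow> real"
  assumes "k_graph k H"
  shows "subhypergraph J H \<Longrightarrow> d J \<le> Max {d J | J. subhypergraph J H}"
    and "\<exists>J. subhypergraph J H \<and> Max {d J | J. subhypergraph J H} = d J"
proof -
  have fin: "finite {d J | J. subhypergraph J H}"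
    using finite_subhypergraphs[OF assms] by (rule finite_image_set)
  show "d J \<le> Max {d J | J. subhypergraph J H}" if "subhypergraph J H"
    using fin that by (intro Max_ge) auto
  have "Max {d J | J. subhypergraph J H} \<in> {d J | J. subhypergraph J H}"
    using fin subhypergraph_refl[OF assms] by (intro Max_in) auto
  then show "\<exists>J. subhypergraph J H \<and> Max {d J | J. subhypergraph J H} = d J" by auto
qed

text \<open>The bound is the density of the subhypergraph induced on \<open>W\<close>. For empty
  \<open>W\<close> the condition \<open>k \<ge> 1\<close> excludes an empty edge.\<close>

lemma card_induced_edges_le:
  assumes "k_graph k G" "k \<ge> 1" "max_dens G \<le> q" "W \<subseteq> verts G"
  shows "real (card {e \<in> hedges G. e \<subseteq> W}) \<le> q * real (card W)"
proof (cases "W = {}")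
  case True
  have "{e \<in> hedges G. e \<subseteq> {}} = {}" using assms(1,2) by (auto simp: k_graph_def)
  then show ?thesis using True by simp
next
  case False
  have "finite W" using assms(4) k_graph_finite(1)[OF assms(1)] finite_subset by blast
  then have pos: "card W > 0" using False by (simp add: card_gt_0_iff)
  let ?J = "Hypergraph W {e \<in> hedges G. e \<subseteq> W}"
  have "subhypergraph ?J G" using assms(4) by (auto simp: subhypergraph_def)
  then have "dens ?J \<le> q"
    using Max_over_subhypergraphs(1)[OF assms(1), of ?J dens] assms(3) unfolding max_dens_def by linarith
  then show ?thesis
    using pos by (simp add: dens_def v_num_def e_num_def divide_le_eq split: if_splits)
qed

lemma max_dens_gt_witness:
  assumes "k_graph k H" "max_dens H > real b"
  shows "\<exists>J. subhypergraph J H \<and> b * card (verts J) < card (hedges J)"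
proof -
  obtain J where J: "subhypergraph J H" "max_dens H = dens J"
    using Max_over_subhypergraphs(2)[OF assms(1), of dens] unfolding max_dens_def by blast
  have "v_num J \<ge> 1" "real b < real (e_num J) / real (v_num J)"
    using assms(2) J(2) by (auto simp: dens_def split: if_splits)
  then have "real (b * v_num J) < real (e_num J)" by (simp add: less_divide_eq)
  then have "b * v_num J < e_num J" by (simp only: of_nat_less_iff)
  then show ?thesis using J(1) unfolding v_num_def e_num_def by blast
qed

lemma e_num_le_choose:
  assumes "k_graph k H"
  shows "e_num H \<le> v_num H choose k"
proof -
  have "card (hedges H) \<le> card {e. e \<subseteq> verts H \<and> card e = k}"
    using assms k_graph_finite(1)[OF assms] by (intro card_mono) (auto simp: k_graph_def)
  then show ?thesis
    using n_subsets[OF k_graph_finite(1)[OF assms]] by (simp add: e_num_def v_num_def)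
qed

definition delete_vertex :: "'a hypergraph \<Rightarrow> 'a \<Rightarrow> 'a hypergraph" where
  "delete_vertex H x = Hypergraph (verts H - {x}) {e \<in> hedges H. x \<notin> e}"

lemma delete_vertex:
  assumes "k_graph k H" "x \<in> verts H"
  shows "subhypergraph (delete_vertex H x) H" "delete_vertex H x \<noteq> H"
    "real (v_num (delete_vertex H x)) = real (v_num H) - 1"
    "real (e_num (delete_vertex H x)) = real (e_num H) - real (card {e \<in> hedges H. x \<in> e})"
proof -
  note fin = k_graph_finite[OF assms(1)]
  show "subhypergraph (delete_vertex H x) H"
    using assms by (auto simp: delete_vertex_def subhypergraph_def k_graph_def)
  show "delete_vertex H x \<noteq> H"
    using assms(2) by (cases H) (auto simp: delete_vertex_def)
  have "Suc (card (verts H - {x})) = card (verts H)"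
    using fin(1) assms(2) by (rule card_Suc_Diff1)
  then show "real (v_num (delete_vertex H x)) = real (v_num H) - 1"
    by (simp add: delete_vertex_def v_num_def)
  have "card {e \<in> hedges H. x \<notin> e} + card {e \<in> hedges H. x \<in> e}
      = card ({e \<in> hedges H. x \<notin> e} \<union> {e \<in> hedges H. x \<in> e})"
    using fin by (intro card_Un_disjoint[symmetric]) auto
  also have "{e \<in> hedges H. x \<notin> e} \<union> {e \<in> hedges H. x \<in> e} = hedges H" by blast
  finally show "real (e_num (delete_vertex H x)) = real (e_num H) - real (card {e \<in> hedges H. x \<in> e})"
    by (simp add: delete_vertex_def e_num_def flip: of_nat_add)
qed

lemma subhypergraph_v_num_le:
  assumes "k_graph k H" "subhypergraph J H"
  shows "v_num J \<le> v_num H"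
  using assms k_graph_finite(1)[OF assms(1)]
  by (auto simp: v_num_def subhypergraph_def intro: card_mono)

text \<open>The other two cases of \<open>k_dens\<close> have values at most 1, so a maximiser has
  an edge and at least \<open>k + 1\<close> vertices.\<close>

lemma max_k_dens_gt_one:
  assumes "k_graph k H" "k \<ge> 2" "max_k_dens k H > 1"
  shows "hedges H \<noteq> {}" "v_num H \<ge> k + 1"
proof -
  obtain J where J: "subhypergraph J H" "max_k_dens k H = k_dens k J"
    using Max_over_subhypergraphs(2)[OF assms(1), of "k_dens k"] unfolding max_k_dens_def by blast
  have "1 / real k \<le> 1" using assms(2) by simp
  then have "hedges J \<noteq> {} \<and> v_num J \<ge> k + 1"
    using J(2) assms(3) unfolding k_dens_def by (auto split: if_splits)
  then show "hedges H \<noteq> {}" "v_num H \<ge> k + 1"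
    using J(1) subhypergraph_v_num_le[OF assms(1) J(1)] by (auto simp: subhypergraph_def)
qed

text \<open>The maximum is attained by some subhypergraph, and strictness leaves only
  \<open>H\<close> itself.\<close>

lemma strictly_k_balanced_edges:
  assumes "k_graph k H" "k \<ge> 2" "max_k_dens k H > 1" "strictly_k_balanced k H"
  shows "real (e_num H) = 1 + max_k_dens k H * (real (v_num H) - real k)"
proof -
  obtain J where J: "subhypergraph J H" "max_k_dens k H = k_dens k J"
    using Max_over_subhypergraphs(2)[OF assms(1), of "k_dens k"] unfolding max_k_dens_def by blast
  have "J = H"
    using assms(4) J by (metis less_irrefl strictly_k_balanced_def)
  then have "max_k_dens k H = (real (e_num H) - 1) / (real (v_num H) - real k)"
    using J(2) max_k_dens_gt_one[OF assms(1-3)] by (simp add: k_dens_def)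
  moreover have "real (v_num H) - real k > 0" using max_k_dens_gt_one(2)[OF assms(1-3)] by simp
  ultimately show ?thesis by (simp add: field_simps)
qed

text \<open>Compare \<open>H\<close> with \<open>H\<close> minus \<open>x\<close>. That still has at
  least \<open>k + 1\<close> vertices, so its density is given by the quotient formula unless it has
  no edges. In that case \<open>x\<close> lies in all edges.\<close>

lemma strictly_k_balanced_degree:
  assumes "k_graph k H" "k \<ge> 2" "max_k_dens k H > 1" "strictly_k_balanced k H"
    and "v_num H \<ge> k + 2" "x \<in> verts H"
  shows "max_k_dens k H < real (card {e \<in> hedges H. x \<in> e})"
proof -
  define m where "m = max_k_dens k H"
  define J where "J = delete_vertex H x"
  note del = delete_vertex[OF assms(1,6), folded J_def]
  have e: "real (e_num H) = 1 + m * (real (v_num H) - real k)"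
    using strictly_k_balanced_edges[OF assms(1-4)] by (simp add: m_def)
  have gap: "real (v_num H) - 1 - real k > 0" using assms(5) by simp
  show ?thesis
  proof (cases "hedges J = {}")
    case True
    then have "real (card {e \<in> hedges H. x \<in> e}) = real (e_num H)"
      using del(4) by (simp add: e_num_def)
    moreover have "m * 1 \<le> m * (real (v_num H) - real k)"
      using gap assms(3) by (intro mult_left_mono) (auto simp: m_def)
    ultimately show ?thesis using e by (simp add: m_def)
  next
    case False
    have "v_num J \<ge> k + 1" using del(3) assms(5) by linarith
    then have "k_dens k J = (real (e_num J) - 1) / (real (v_num H) - 1 - real k)"
      using False del(3) by (simp add: k_dens_def)
    moreover have "k_dens k J < m"
      using assms(4) del(1,2) by (simp add: strictly_k_balanced_def m_def)
    ultimately have "real (e_num J) - 1 < m * (real (v_num H) - 1 - real k)"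
      using gap by (simp add: divide_less_eq)
    then show ?thesis using e del(4) by (simp add: m_def algebra_simps)
  qed
qed

text \<open>A division-free form of the density bound that also covers \<open>v_num J = k\<close>,
  where at most one edge is possible.\<close>

lemma e_num_le_of_k_dens:
  assumes "k_graph k J" "k_dens k J \<le> m" "v_num J \<ge> k" "m \<ge> 0"
  shows "real (e_num J) \<le> 1 + m * (real (v_num J) - real k)"
proof (cases "v_num J = k")
  case True
  then show ?thesis using e_num_le_choose[OF assms(1)] by simp
next
  case False
  then have gap: "real (v_num J) - real k > 0" "v_num J \<ge> k + 1" using assms(3) by auto
  show ?thesis
  proof (cases "hedges J = {}")
    case True
    then show ?thesis using gap assms(4) by (simp add: e_num_def)
  next
    case False
    then have "(real (e_num J) - 1) / (real (v_num J) - real k) \<le> m"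
      using assms(2) gap by (simp add: k_dens_def)
    then show ?thesis using gap(1) by (simp add: divide_le_eq)
  qed
qed

text \<open>A single edge of \<open>H1\<close> has asymmetric density \<open>m2\<close>, which gives
  the lower bound. For the upper one, \<open>e_num J\<close> is at most
  \<open>1 + m1 * (v_num J - k)\<close>, and \<open>1 \<le> m1 / m2\<close>.\<close>

lemma max_asym_dens_bounds:
  assumes "k \<ge> 2" "k_graph k H1" "k_graph k H2"
    and "max_k_dens k H1 \<ge> max_k_dens k H2" "max_k_dens k H2 > 1"
  shows "max_k_dens k H2 \<le> max_asym_dens k H1 H2" "max_asym_dens k H1 H2 \<le> max_k_dens k H1"
proof -
  define m1 where "m1 = max_k_dens k H1"
  define m2 where "m2 = max_k_dens k H2"
  have m: "1 < m2" "m2 \<le> m1" using assms(4,5) by (simp_all add: m1_def m2_def)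
  have H2: "hedges H2 \<noteq> {}" using max_k_dens_gt_one[OF assms(3,1,5)] by simp
  have "max_k_dens k H1 > 1" using assms(4,5) by simp
  then obtain e where e: "e \<in> hedges H1" using max_k_dens_gt_one[OF assms(2,1)] by blast
  let ?J = "Hypergraph e {e}"
  have ke: "e \<subseteq> verts H1" "card e = k" using e assms(2) by (auto simp: k_graph_def)
  have "subhypergraph ?J H1" using e ke by (auto simp: subhypergraph_def)
  then have "asym_dens k ?J H2 \<le> max_asym_dens k H1 H2"
    using Max_over_subhypergraphs(1)[OF assms(2), of ?J "\<lambda>J. asym_dens k J H2"]
    unfolding max_asym_dens_def by simp
  moreover have "asym_dens k ?J H2 = m2"
    using H2 ke by (simp add: asym_dens_def v_num_def e_num_def m2_def)
  ultimately show "max_k_dens k H2 \<le> max_asym_dens k H1 H2" by (simp add: m2_def)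
  obtain J where J: "subhypergraph J H1" "max_asym_dens k H1 H2 = asym_dens k J H2"
    using Max_over_subhypergraphs(2)[OF assms(2), of "\<lambda>J. asym_dens k J H2"]
    unfolding max_asym_dens_def by blast
  have "asym_dens k J H2 \<le> m1"
  proof (cases "v_num J \<ge> k")
    case True
    have "k_dens k J \<le> m1"
      using Max_over_subhypergraphs(1)[OF assms(2) J(1), of "k_dens k"]
      unfolding m1_def max_k_dens_def .
    then have "real (e_num J) \<le> 1 + m1 * (real (v_num J) - real k)"
      using e_num_le_of_k_dens[OF k_graph_subhypergraph[OF assms(2) J(1)] _ True] m by simp
    also have "1 \<le> m1 * (1 / m2)" using m by simp
    finally have "real (e_num J) \<le> m1 * (real (v_num J) - real k + 1 / m2)"
      by (simp add: algebra_simps)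
    moreover have "real (v_num J) - real k + 1 / m2 > 0" using True m by (simp add: add_nonneg_pos)
    ultimately show ?thesis
      using H2 True by (simp add: asym_dens_def divide_le_eq flip: m2_def)
  next
    case False
    then show ?thesis using m by (simp add: asym_dens_def)
  qed
  then show "max_asym_dens k H1 H2 \<le> max_k_dens k H1" using J(2) by (simp add: m1_def)
qed

text \<open>If the two k-densities agree, both bounds on the asymmetric density coincide and the
  claim is the edge count of a strictly k-balanced hypergraph. Otherwise only \<open>H1\<close>
  attains the maximum.\<close>

lemma heart_edges:
  assumes "k \<ge> 2" "k_graph k H1" "k_graph k H2" "max_k_dens k H2 > 1" "heart k H1 H2"
  shows "real (e_num H1)
    = max_asym_dens k H1 H2 * (real (v_num H1) - real k + 1 / max_k_dens k H2)"
proof -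
  define m2 where "m2 = max_k_dens k H2"
  define M where "M = max_asym_dens k H1 H2"
  have ge: "max_k_dens k H1 \<ge> max_k_dens k H2" using assms(5) by (simp add: heart_def)
  then have gt: "max_k_dens k H1 > 1" using assms(4) by simp
  note bounds = max_asym_dens_bounds[OF assms(1-3) ge assms(4)]
  have H2: "hedges H2 \<noteq> {}" using max_k_dens_gt_one[OF assms(3,1,4)] by simp
  have v: "v_num H1 \<ge> k + 1" by (rule max_k_dens_gt_one(2)[OF assms(2,1) gt])
  show ?thesis
  proof (cases "max_k_dens k H1 = m2")
    case True
    then have "strictly_k_balanced k H1" using assms(5) by (simp add: heart_def m2_def)
    from strictly_k_balanced_edges[OF assms(2,1) gt this]
    have "real (e_num H1) = 1 + m2 * (real (v_num H1) - real k)" using True by simp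
    moreover have "M = m2" using bounds True by (simp add: M_def m2_def)
    ultimately show ?thesis
      using assms(4) by (simp add: algebra_simps flip: M_def m2_def)
  next
    case False
    then have bal: "strictly_balanced_wrt k H1 H2" using assms(5) ge by (simp add: heart_def m2_def)
    obtain J where J: "subhypergraph J H1" "max_asym_dens k H1 H2 = asym_dens k J H2"
      using Max_over_subhypergraphs(2)[OF assms(2), of "\<lambda>J. asym_dens k J H2"]
      unfolding max_asym_dens_def by blast
    have "J = H1" using bal J by (metis less_irrefl strictly_balanced_wrt_def)
    then have "M = real (e_num H1) / (real (v_num H1) - real k + 1 / m2)"
      using J(2) H2 v by (simp add: asym_dens_def M_def m2_def)
    moreover have "real (v_num H1) - real k + 1 / m2 > 0"
      using v assms(4) by (simp add: add_nonneg_pos m2_def)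
    ultimately show ?thesis by (simp add: M_def m2_def)
  qed
qed

text \<open>The exception cannot be dropped: for a pair of triangles the density is 2, which is also the
  minimum degree.\<close>

lemma heart_degree:
  assumes "k \<ge> 2" "k_graph k H1" "k_graph k H2" "max_k_dens k H2 > 1" "heart k H1 H2"
    and "\<not> (v_num H1 = k + 1 \<and> max_k_dens k H1 = max_k_dens k H2)" "x \<in> verts H1"
  shows "max_asym_dens k H1 H2 < real (card {e \<in> hedges H1. x \<in> e})"
proof -
  define m2 where "m2 = max_k_dens k H2"
  define M where "M = max_asym_dens k H1 H2"
  have ge: "max_k_dens k H1 \<ge> max_k_dens k H2" using assms(5) by (simp add: heart_def)
  then have gt: "max_k_dens k H1 > 1" using assms(4) by simp
  note bounds = max_asym_dens_bounds[OF assms(1-3) ge assms(4)]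
  have v: "v_num H1 \<ge> k + 1" by (rule max_k_dens_gt_one(2)[OF assms(2,1) gt])
  show ?thesis
  proof (cases "max_k_dens k H1 = m2")
    case True
    then have "strictly_k_balanced k H1" using assms(5) by (simp add: heart_def m2_def)
    moreover have "v_num H1 \<ge> k + 2" using True assms(6) v by (simp add: m2_def)
    ultimately show ?thesis
      using strictly_k_balanced_degree[OF assms(2,1) gt _ _ assms(7)] bounds(2) by fastforce
  next
    case False
    then have bal: "strictly_balanced_wrt k H1 H2" using assms(5) ge by (simp add: heart_def m2_def)
    have H2: "hedges H2 \<noteq> {}" using max_k_dens_gt_one[OF assms(3,1,4)] by simp
    define J where "J = delete_vertex H1 x"
    note del = delete_vertex[OF assms(2,7), folded J_def]
    have pos: "real (v_num H1) - 1 - real k + 1 / m2 > 0"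
      using v assms(4) by (simp add: add_nonneg_pos m2_def)
    \<comment> \<open>For the asymmetric density \<open>k\<close> vertices suffice for the quotient
      formula, so \<open>v_num H1 = k + 1\<close> is no exception in this case.\<close>
    have "v_num J \<ge> k" using del(3) v by linarith
    then have "asym_dens k J H2 = real (e_num J) / (real (v_num H1) - 1 - real k + 1 / m2)"
      using H2 del(3) by (simp add: asym_dens_def m2_def)
    moreover have "asym_dens k J H2 < M"
      using bal del(1,2) by (simp add: strictly_balanced_wrt_def M_def)
    ultimately have "real (e_num J) < M * (real (v_num H1) - 1 - real k + 1 / m2)"
      using pos by (simp add: divide_less_eq)
    then show ?thesis
      using heart_edges[OF assms(1-5)] del(4) by (simp add: algebra_simps flip: M_def m2_def)
  qed
qed

section \<open>From vertex partitions to edge colourings\<close>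

text \<open>Edges inside a part get colour 1. A copy of \<open>H2\<close> in colour 2 would pull the
  partition back to a weak colouring of \<open>H2\<close> with \<open>k\<close> colours.\<close>

lemma not_arrows_of_splits:
  assumes "k_graph k G" "\<not> weakly_colourable H2 k" "splits (hedges G) k H1 (verts G)"
  shows "\<not> arrows G H1 H2"
proof -
  obtain p where p: "\<forall>x\<in>verts G. p x < k"
      "\<not> embeds H1 (verts G) (mono_edges (hedges G) (verts G) p)"
    using assms(3) unfolding splits_def by blast
  have "\<not> embeds H2 (verts G) (hedges G - mono_edges (hedges G) (verts G) p)"
  proof
    assume "embeds H2 (verts G) (hedges G - mono_edges (hedges G) (verts G) p)"
    then obtain f where f: "f ` verts H2 \<subseteq> verts G"
        "\<forall>e\<in>hedges H2. f ` e \<in> hedges G - mono_edges (hedges G) (verts G) p"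
      unfolding embeds_def by blast
    have "\<not> (\<exists>i. \<forall>x\<in>e. p (f x) = i)" if e: "e \<in> hedges H2" for e
    proof
      assume "\<exists>i. \<forall>x\<in>e. p (f x) = i"
      then have "\<exists>i. \<forall>y\<in>f ` e. p y = i" by simp
      moreover have "f ` e \<in> hedges G" "f ` e \<subseteq> verts G"
        using f(2) e assms(1) by (auto simp: k_graph_def)
      ultimately have "f ` e \<in> mono_edges (hedges G) (verts G) p" by (simp add: mono_edges_def)
      then show False using f(2) e by blast
    qed
    moreover have "\<forall>x\<in>verts H2. p (f x) < k" using p(1) f(1) by blast
    ultimately have "weakly_colourable H2 k"
      unfolding weakly_colourable_def by (intro exI[of _ "\<lambda>x. p (f x)"]) simp
    then show False using assms(2) by simp
  qed
  with p(2) show ?thesis by (rule not_arrowsI)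
qed

section \<open>A binomial estimate for condition (ii)\<close>

lemma Suc_times_choose_Suc: "Suc j * (n choose Suc j) = (n - j) * (n choose j)"
  by (simp only: binomial_absorption binomial_absorb_comp)

text \<open>The hypothesis says that \<open>H1\<close> cannot have more edges than there are
  k-subsets. The conclusion bounds the gap between \<open>M * v\<close> and the edge number
  \<open>M * (v - k + 1 / m)\<close>, so that the coloured remainder of about
  \<open>(M - (v choose (k - 2))) * v\<close> edges is too small for \<open>H1\<close>.\<close>

lemma asym_dens_choose_bound:
  fixes M m :: real and k v :: nat
  assumes "k \<ge> 2" "v \<ge> k + 1" "1 < m" "m \<le> M"
    and "M * (real v - real k + 1 / m) \<le> real (v choose k)"
  shows "M * (real k - 1 / m) \<le> real (v choose (k - 2)) * real v"
proof (cases "k = 2")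
  case True
  have "1 \<le> M / m" using assms(3,4) by simp
  have "(v choose 2) * 2 = v * (v - 1)"
    using Suc_times_choose_Suc[of 1 v] by (simp add: numeral_2_eq_2)
  then have "real (v choose 2) * 2 = real v * (real v - 1)"
    using assms(2) by (metis of_nat_mult of_nat_numeral of_nat_1 of_nat_diff add_leD2)
  then have "2 * (M * (real v - 2)) + 2 \<le> real v * (real v - 1)"
    using assms(5) True \<open>1 \<le> M / m\<close> by (simp add: algebra_simps)
  \<comment> \<open>Since \<open>v * (v - 1) - 2 = (v + 1) * (v - 2)\<close>, the factor
    \<open>v - 2\<close> cancels. The term \<open>M / m\<close>, at least 1, then absorbs the excess
    1 in \<open>v + 1\<close>.\<close>
  then have "2 * M * (real v - 2) \<le> (real v + 1) * (real v - 2)"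
    by (simp add: algebra_simps)
  then have "2 * M \<le> real v + 1"
    using assms(2) True by simp
  then show ?thesis using True \<open>1 \<le> M / m\<close> by (simp add: algebra_simps)
next
  case False
  then obtain j where k: "k = Suc (Suc j)" "j \<ge> 1"
    using assms(1) by (metis One_nat_def Suc_1 Suc_le_D Suc_leI le_neq_implies_less not_less_eq_eq)
  obtain x where x: "v = k + x" "x \<ge> 1" using assms(2) le_Suc_ex[of "k" v] by auto
  define C where "C = real (v choose j)"
  have "Suc (Suc j) * (v choose k) = (x + 1) * (v choose Suc j)"
    using Suc_times_choose_Suc[of "Suc j" v] k(1) x(1) by simp
  moreover have "Suc j * (v choose Suc j) = (x + 2) * (v choose j)"
    using Suc_times_choose_Suc[of j v] k(1) x(1) by simp
  ultimately have "Suc (Suc j) * (Suc j * (v choose k)) = (x + 1) * ((x + 2) * (v choose j))"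
    by (metis mult.left_commute)
  then have "real (Suc (Suc j) * (Suc j * (v choose k))) = real ((x + 1) * ((x + 2) * (v choose j)))"
    by (rule arg_cong)
  then have "real (Suc (Suc j)) * (real (Suc j) * real (v choose k)) = (real x + 1) * (real x + 2) * C"
    by (simp only: of_nat_mult of_nat_add of_nat_1 of_nat_numeral C_def mult.assoc)
  moreover have "real (Suc (Suc j)) = real k" "real (Suc j) = real k - 1" using k(1) by simp_all
  \<comment> \<open>Absorption applied twice, with \<open>x = v - k\<close> and \<open>C\<close> the
    binomial coefficient for \<open>k - 2\<close>. It yields the stronger bound
    \<open>M * k \<le> C * v\<close>.\<close>
  ultimately have id: "real k * ((real k - 1) * real (v choose k)) = (real x + 1) * (real x + 2) * C"
    by (simp only:)
  have M0: "M > 0" using assms(3,4) by simp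
  have "M * real x \<le> M * (real x + 1 / m)" using M0 assms(3) by (intro mult_left_mono) auto
  then have "M * real x \<le> real (v choose k)" using assms(5) x by simp
  then have "real k * ((real k - 1) * (M * real x)) \<le> (real x + 1) * (real x + 2) * C"
    unfolding id[symmetric] using k by (intro mult_left_mono) auto
  also have "\<dots> \<le> (real k - 1) * real x * (real x + real k) * C"
  proof (rule mult_right_mono)
    have "(real x + 1) * (real x + 2) \<le> 2 * (real x * (real x + 3))"
    proof -
      have "1 * 1 \<le> real x * real x" using x by (intro mult_mono) auto
      then show ?thesis using x by (simp add: algebra_simps)
    qed
    also have "\<dots> \<le> (real k - 1) * (real x * (real x + real k))"
      using k by (intro mult_mono) auto
    finally show "(real x + 1) * (real x + 2) \<le> (real k - 1) * real x * (real x + real k)"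
      by (simp add: mult.assoc)
  qed (simp add: C_def)
  finally have "((real k - 1) * real x) * (M * real k) \<le> ((real k - 1) * real x) * (C * real v)"
    using x(1) by (simp add: algebra_simps)
  moreover have "(real k - 1) * real x > 0" using k x by simp
  ultimately have "M * real k \<le> C * real v" by (simp only: mult_le_cancel_left_pos)
  moreover have "M * (real k - 1 / m) \<le> M * real k"
    using M0 assms(3) by (intro mult_left_mono) auto
  ultimately show ?thesis using k by (simp add: C_def)
qed

theorem lemma1p10:
  fixes k :: nat
    and G :: "'g hypergraph" and H1 :: "'a hypergraph" and H2 :: "'b hypergraph"
  assumes "k \<ge> 2"
    and "k_graph k G" and "k_graph k H1" and "k_graph k H2"
    and "max_k_dens k H1 \<ge> max_k_dens k H2" and "max_k_dens k H2 > 1"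
    and "max_dens G \<le> max_asym_dens k H1 H2"
    and "heart k H1 H2"
    and "weak_chromatic_number H2 \<ge> k + 1 \<or>
         max_dens H2 > real (v_num H1 choose (k - 2)) + 1"
  shows "\<not> arrows G H1 H2"
proof -
  define M where "M = max_asym_dens k H1 H2"
  define m2 where "m2 = max_k_dens k H2"
  have M: "m2 \<le> M" "M \<le> max_k_dens k H1" "1 < m2"
    using max_asym_dens_bounds[OF assms(1,3-6)] assms(6) by (simp_all add: M_def m2_def)
  have gt1: "max_k_dens k H1 > 1" using assms(5,6) by simp
  have v1: "v_num H1 \<ge> k + 1" by (rule max_k_dens_gt_one(2)[OF assms(3,1) gt1])
  have e1: "real (e_num H1) = M * (real (v_num H1) - real k + 1 / m2)"
    using heart_edges[OF assms(1,3,4,6,8)] by (simp add: M_def m2_def)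
  have G: "\<forall>e\<in>hedges G. card e = k" "finite (hedges G)" "finite (verts G)"
    using assms(2) k_graph_finite[OF assms(2)] by (auto simp: k_graph_def)
  have dens: "real (card {e \<in> hedges G. e \<subseteq> W}) \<le> M * real (card W)" if "W \<subseteq> verts G" for W
    using card_induced_edges_le[OF assms(2) _ assms(7) that] assms(1) by (simp add: M_def)
  show ?thesis
    using assms(9)
  proof
    assume "weak_chromatic_number H2 \<ge> k + 1"
    then have chi: "\<not> weakly_colourable H2 k"
      unfolding weak_chromatic_number_def
      using Least_le[of "weakly_colourable H2" k] by auto
    show ?thesis
    proof (cases "v_num H1 = k + 1 \<and> max_k_dens k H1 = max_k_dens k H2")
      case False
      \<comment> \<open>The least integer exceeding \<open>M\<close>, which need not be an integer
        itself.\<close>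
      have "nat \<lfloor>M\<rfloor> + 1 \<le> card {e \<in> hedges H1. x \<in> e}" if "x \<in> verts H1" for x
        using heart_degree[OF assms(1,3,4,6,8) False that] M by (simp add: M_def) linarith
      moreover have "M < real (nat \<lfloor>M\<rfloor> + 1)" using M by linarith
      moreover have "verts H1 \<noteq> {}" using v1 by (auto simp: v_num_def)
      ultimately have "splits (hedges G) k H1 (verts G)"
        using splits_of_min_degree[OF G(1) assms(1) G(2,3) assms(3) _ _ dens] by blast
      then show ?thesis by (rule not_arrows_of_splits[OF assms(2) chi])
    next
      case True
      then have Mm2: "M = m2" using M by (simp add: m2_def)
      have "real (v_num H1) - real k = 1" using True by simp
      \<comment> \<open>So \<open>M\<close> is an integer in the exceptional case, as the tight
        argument requires.\<close>
      then have Me: "real (e_num H1) = M + 1" using e1 Mm2 M by (simp add: distrib_left)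
      obtain m where m: "e_num H1 = Suc m" "M = real m"
        using M Me by (cases "e_num H1") auto
      have m2: "m \<ge> 2" using m M by simp
      have nat_dens: "card {e \<in> hedges G. e \<subseteq> W} \<le> m * card W" if "W \<subseteq> verts G" for W
        using dens[OF that] m(2) by (simp flip: of_nat_mult)
      have H1: "card (verts H1) = Suc k" "card (hedges H1) = Suc m"
        using True m by (simp_all add: v_num_def e_num_def)
      show ?thesis
      proof (cases "k = 2")
        case False
        then have "k \<ge> 3" using assms(1) by simp
        then have "splits (hedges G) k H1 (verts G)"
          using splits_of_tight_density[OF G(1) _ G(2,3) assms(3) H1 m2 nat_dens] by blast
        then show ?thesis by (rule not_arrows_of_splits[OF assms(2) chi])
      next
        case k: True
        \<comment> \<open>Three vertices span at most three edges, so \<open>H1\<close> is a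
          triangle and \<open>M = 2\<close>. Then \<open>H2\<close> has density 2: it is a triangle
          too, or its minimum degree is at least 3.\<close>
        have "e_num H1 \<le> 3" using e_num_le_choose[OF assms(3)] True k by (simp add: choose_two)
        then have "m = 2" using m m2 by simp
        have G': "\<forall>e\<in>hedges G. card e = 2" "k_graph 2 H1" "k_graph 2 H2"
          using G(1) assms(3,4) k by simp_all
        have H1': "card (verts H1) = 3" "card (hedges H1) = 3"
          using H1 k \<open>m = 2\<close> by simp_all
        have nat_dens': "card {e \<in> hedges G. e \<subseteq> W} \<le> 2 * card W" if "W \<subseteq> verts G" for W
          using nat_dens[OF that] \<open>m = 2\<close> by simp
        have two: "max_k_dens k H2 = 2" using Mm2 m \<open>m = 2\<close> by (simp add: m2_def)
        have bal: "strictly_k_balanced k H2" using assms(8) by (simp add: heart_def)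
        have v2: "v_num H2 \<ge> 3" using max_k_dens_gt_one(2)[OF assms(4,1,6)] k by simp
        show ?thesis
        proof (cases "v_num H2 = 3")
          case True
          then have "card (verts H2) = 3" "card (hedges H2) = 3"
            using strictly_k_balanced_edges[OF assms(4,1,6) bal] two k
            by (simp_all add: v_num_def e_num_def)
          then have "\<exists>R. \<not> embeds H1 (verts G) R \<and> \<not> embeds H2 (verts G) (hedges G - R)"
            using two_triangle_free_parts[OF G'(1) G(2,3) nat_dens' G'(2) H1' G'(3)] by blast
          then show ?thesis using not_arrowsI by blast
        next
          case False
          then have "k + 2 \<le> v_num H2" using v2 k by simp
          from strictly_k_balanced_degree[OF assms(4,1,6) bal this] two
          have "\<forall>x\<in>verts H2. 3 \<le> card {e \<in> hedges H2. x \<in> e}" by force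
          moreover have "verts H2 \<noteq> {}" using v2 by (auto simp: v_num_def)
          moreover have "{e \<in> hedges G. e \<subseteq> verts G} = hedges G"
            using assms(2) by (auto simp: k_graph_def)
          ultimately have "\<exists>R. \<not> embeds H1 (verts G) R \<and> \<not> embeds H2 (verts G) (hedges G - R)"
            using triangle_versus_min_degree_three[OF G'(1) G(2,3) nat_dens' G'(2) H1' G'(3)]
            by metis
          then show ?thesis using not_arrowsI by blast
        qed
      qed
    qed
  next
    define b where "b = (v_num H1 choose (k - 2)) + 1"
    define q where "q = nat \<lceil>M\<rceil>"
    assume "max_dens H2 > real (v_num H1 choose (k - 2)) + 1"
    then have "max_dens H2 > real b" by (simp add: b_def)
    then obtain J where J: "subhypergraph J H2" "b * card (verts J) < card (hedges J)"
      using max_dens_gt_witness[OF assms(4)] by blast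
    have q: "M \<le> real q" "real q < M + 1" using M by (simp_all add: q_def) linarith+
    have "card {e \<in> hedges G. e \<subseteq> W} \<le> q * card W" if "W \<subseteq> verts G" for W
    proof -
      have "real (card {e \<in> hedges G. e \<subseteq> W}) \<le> M * real (card W)" by (rule dens[OF that])
      also have "\<dots> \<le> real q * real (card W)" using q(1) by (rule mult_right_mono) simp
      finally show ?thesis by (simp flip: of_nat_mult)
    qed
    moreover have "(q - b) * card (verts H1) < card (hedges H1)"
    proof (cases "q \<le> b")
      case True
      have "real (e_num H1) > 0" unfolding e1 using M v1 by (simp add: add_nonneg_pos)
      then show ?thesis using True by (simp add: e_num_def)
    next
      case False
      have "M * (real k - 1 / m2) \<le> real (v_num H1 choose (k - 2)) * real (v_num H1)"
        using e_num_le_choose[OF assms(3)] M v1 assms(1)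
        by (intro asym_dens_choose_bound) (simp_all flip: e1)
      \<comment> \<open>The 1 in \<open>b\<close> cancels the rounding allowance in
        \<open>M + 1\<close>; strictness comes from \<open>q < M + 1\<close>.\<close>
      then have "(M + 1 - real b) * real (v_num H1) \<le> real (e_num H1)"
        unfolding e1 b_def by (simp add: algebra_simps)
      moreover have "(real q - real b) * real (v_num H1) < (M + 1 - real b) * real (v_num H1)"
        using q(2) v1 by (intro mult_strict_right_mono) auto
      ultimately have "real ((q - b) * v_num H1) < real (e_num H1)"
        using False by (simp add: of_nat_diff)
      then show ?thesis by (simp only: of_nat_less_iff v_num_def e_num_def)
    qed
    ultimately show ?thesis
      using not_arrows_by_orientation[OF assms(2-4) _ _ J] by blast
  qed
qed

end
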